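(* Let $(A,\cdot,+)$ be a linear cycle set and $\Gamma$ be an abelian group. Associating to a central extension $0\to\Gamma\overset{\iota}{\to}E\overset{\pi}{\to}A\to 0$ the class in $H^2_{\mathrm N}(A;\Gamma)$ of the normalized $2$-cocycle $(f,g)$ determined by $$\iota(f(a,a'))=s(a)\cdot s(a')-s(a\cdot a'),\qquad \iota(g(a,a'))=s(a)+s(a')-s(a+a'),\qquad a,a'\in A,$$ where $s\colon A\to E$ is any set-theoretic section of $\pi$ with $s(0)=0$, yields a well-defined bijective correspondence $$\operatorname{Ext}(A,\Gamma)\overset{1:1}{\longleftrightarrow}H^2_{\mathrm N}(A;\Gamma).$$
   Context: A cycle set is a set $X$ with a binary operation $\cdot$ such that all left translations $a\mapsto b\cdot a$ are bijective and $(a\cdot b)\cdot(a\cdot c)=(b\cdot a)\cdot(b\cdot c)$ for all $a,b,c$. A linear cycle set (LCS) is a cycle set $(A,\cdot)$ with an abelian group operation $+$ satisfying $a\cdot(b+c)=a\cdot b+a\cdot c$ and $(a+b)\cdot c=(a\cdot b)\cdot(a\cdot c)$ for all $a,b,c\in A$. A morphism of LCS is a map preserving $+$ and $\cdot$; its kernel is the preimage of $0$; short exact sequences of LCS are defined accordingly (injective, image equals kernel, surjective). A linear cycle subset $A'$ of an LCS $B$ is central if $b\cdot a'=a'$ and $a'\cdot b=b$ for all $b\in B$, $a'\in A'$. A central extension of $A$ by $\Gamma$ is a short exact sequence of LCS $0\to\Gamma\overset{\iota}{\to}E\overset{\pi}{\to}A\to 0$, where $\Gamma$ has the trivial cycle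 set structure $\gamma\cdot\gamma'=\gamma'$ and $\iota(\Gamma)$ is central in $E$. Two such extensions $(E,\iota,\pi)$, $(E',\iota',\pi')$ are equivalent if there is an LCS isomorphism $\varphi\colon E\to E'$ with $\varphi\iota=\iota'$ and $\pi'\varphi=\pi$. $\operatorname{Ext}(A,\Gamma)$ is the set of equivalence classes. A $2$-cocycle of $A$ with coefficients in $\Gamma$ is a pair $(f,g)$ of maps $A\times A\to\Gamma$ such that for all $a,b,c\in A$: $g(a,b)=g(b,a)$; $f(a+b,c)=f(a\cdot b,a\cdot c)+f(a,c)$; $f(a,b+c)-f(a,b)-f(a,c)=g(a\cdot b,a\cdot c)-g(b,c)$; $g(a,b)+g(a+b,c)=g(b,c)+g(a,b+c)$. It is normalized if $f$ and $g$ vanish on all pairs having at least one entry equal to $0$. The normalized $2$-cocycles form an abelian group $Z^2_{\mathrm N}(A;\Gamma)$. A normalized $2$-coboundary is a pair $\partial^1\theta=(f,g)$ with $f(a,b)=\theta(a\cdot b)-\theta(b)$, $g(a,b)=\theta(a+b)-\theta(a)-\theta(b)$ for some map $\theta\colon A\to\Gamma$ with $\theta(0)=0$; these form a subgroup $B^2_{\mathrm N}(A;\Gamma)$. $H^2_{\mathrm N}(A;\Gamma)=Z^2_{\mathrm N}(A;\Gamma)/B^2_{\mathrm N}(A;\Gamma)$. *)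

theory Defs
  imports "HOL-Algebra.Coset" "HOL-Library.Equipollence"
begin

text \<open>
  All abelian groups are written in the multiplicative notation of HOL-Algebra: the group
  operation \<open>+\<close> of the mathematics is \<open>\<otimes>\<close>, its neutral element \<open>0\<close> is \<open>\<one>\<close>, and \<open>x - y\<close> is
  \<open>x \<otimes> inv y\<close>.  The cycle set operation is \<open>\<cdot>\<close>.
\<close>

subsection \<open>Linear cycle sets\<close>

record 'a lcs = "'a monoid" +
  cyc :: "['a, 'a] \<Rightarrow> 'a"  (infixl \<open>\<cdot>\<index>\<close> 75)

locale cycle_set =
  fixes X :: "('a, 'm) lcs_scheme" (structure)
  assumes left_translation_bij: "b \<in> carrier X \<Longrightarrow> bij_betw (\<lambda>a. b \<cdot> a) (carrier X) (carrier X)"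
    and cycle: "\<lbrakk>a \<in> carrier X; b \<in> carrier X; c \<in> carrier X\<rbrakk> \<Longrightarrow>
      (a \<cdot> b) \<cdot> (a \<cdot> c) = (b \<cdot> a) \<cdot> (b \<cdot> c)"

locale linear_cycle_set = comm_group A + cycle_set A
  for A :: "('a, 'm) lcs_scheme" (structure) +
  assumes cyc_add_right: "\<lbrakk>a \<in> carrier A; b \<in> carrier A; c \<in> carrier A\<rbrakk> \<Longrightarrow>
      a \<cdot> (b \<otimes> c) = (a \<cdot> b) \<otimes> (a \<cdot> c)"
    and cyc_add_left: "\<lbrakk>a \<in> carrier A; b \<in> carrier A; c \<in> carrier A\<rbrakk> \<Longrightarrow>
      (a \<otimes> b) \<cdot> c = (a \<cdot> b) \<cdot> (a \<cdot> c)"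

definition lcs_hom :: "[('a, 'm) lcs_scheme, ('b, 'n) lcs_scheme] \<Rightarrow> ('a \<Rightarrow> 'b) set" where
  "lcs_hom A B = {\<phi> \<in> hom A B. \<forall>x\<in>carrier A. \<forall>y\<in>carrier A. \<phi> (x \<cdot>\<^bsub>A\<^esub> y) = \<phi> x \<cdot>\<^bsub>B\<^esub> \<phi> y}"

definition lcs_iso :: "[('a, 'm) lcs_scheme, ('b, 'n) lcs_scheme] \<Rightarrow> ('a \<Rightarrow> 'b) set" where
  "lcs_iso A B = {\<phi> \<in> lcs_hom A B. bij_betw \<phi> (carrier A) (carrier B)}"

definition lcs_short_exact ::
  "[('a, 'k) lcs_scheme, ('b, 'm) lcs_scheme, ('c, 'n) lcs_scheme, 'a \<Rightarrow> 'b, 'b \<Rightarrow> 'c] \<Rightarrow> bool" where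
  "lcs_short_exact A B C \<iota> \<pi> \<longleftrightarrow>
     linear_cycle_set A \<and> linear_cycle_set B \<and> linear_cycle_set C \<and>
     \<iota> \<in> lcs_hom A B \<and> \<pi> \<in> lcs_hom B C \<and>
     inj_on \<iota> (carrier A) \<and>
     \<iota> ` carrier A = kernel B C \<pi> \<and>
     \<pi> ` carrier B = carrier C"

definition linear_cycle_subset :: "['a set, ('a, 'm) lcs_scheme] \<Rightarrow> bool" where
  "linear_cycle_subset S B \<longleftrightarrow> S \<subseteq> carrier B \<and> linear_cycle_set (B\<lparr>carrier := S\<rparr>)"

definition central_linear_cycle_subset :: "['a set, ('a, 'm) lcs_scheme] \<Rightarrow> bool" where
  "central_linear_cycle_subset S B \<longleftrightarrow> linear_cycle_subset S B \<and>
     (\<forall>b\<in>carrier B. \<forall>a\<in>S. b \<cdot>\<^bsub>B\<^esub> a = a \<and> a \<cdot>\<^bsub>B\<^esub> b = b)"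

definition trivial_lcs :: "('g, 'n) monoid_scheme \<Rightarrow> 'g lcs" where
  "trivial_lcs \<Gamma> = \<lparr>carrier = carrier \<Gamma>, mult = mult \<Gamma>, one = one \<Gamma>, cyc = (\<lambda>x y. y)\<rparr>"

subsection \<open>Central extensions\<close>

type_synonym ('g, 'e, 'a) extension = "'e lcs \<times> ('g \<Rightarrow> 'e) \<times> ('e \<Rightarrow> 'a)"

definition central_extension ::
  "[('a, 'm) lcs_scheme, ('g, 'n) monoid_scheme, ('g, 'e, 'a) extension] \<Rightarrow> bool" where
  "central_extension A \<Gamma> = (\<lambda>(E, \<iota>, \<pi>).
     lcs_short_exact (trivial_lcs \<Gamma>) E A \<iota> \<pi> \<and>
     central_linear_cycle_subset (\<iota> ` carrier \<Gamma>) E)"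

definition extension_equiv ::
  "[('g, 'n) monoid_scheme, ('g, 'e, 'a) extension, ('g, 'f, 'a) extension] \<Rightarrow> bool" where
  "extension_equiv \<Gamma> = (\<lambda>(E, \<iota>, \<pi>) (E', \<iota>', \<pi>').
     \<exists>\<phi>\<in>lcs_iso E E'. (\<forall>x\<in>carrier \<Gamma>. \<phi> (\<iota> x) = \<iota>' x) \<and> (\<forall>e\<in>carrier E. \<pi>' (\<phi> e) = \<pi> e))"

text \<open>
  \<open>Ext A \<Gamma>\<close> is relative to the type \<open>'e\<close> of the elements of the middle terms \<open>E\<close>, since HOL has no
  set of all extensions.  The middle term of a central extension is equipotent to the
  product of the two carriers, so this is the full set of equivalence classes as soon as
  \<open>carrier A \<times> carrier \<Gamma>\<close> embeds into \<open>'e\<close> (for instance for \<open>'e = 'a \<times> 'g\<close>), and it is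
  empty for any smaller \<open>'e\<close>.
\<close>

definition extension_rel ::
  "[('a, 'm) lcs_scheme, ('g, 'n) monoid_scheme] \<Rightarrow> ('g, 'e, 'a) extension rel" where
  "extension_rel A \<Gamma> =
     {(X, Y). central_extension A \<Gamma> X \<and> central_extension A \<Gamma> Y \<and> extension_equiv \<Gamma> X Y}"

definition Ext ::
  "[('a, 'm) lcs_scheme, ('g, 'n) monoid_scheme] \<Rightarrow> ('g, 'e, 'a) extension set set" where
  "Ext A \<Gamma> = {X. central_extension A \<Gamma> X} // extension_rel A \<Gamma>"

subsection \<open>Normalized second cohomology\<close>

text \<open>
  Maps \<open>A \<times> A \<rightarrow> \<Gamma>\<close> are represented by extensional functions, so that a pair \<open>(f, g)\<close> is
  determined by its values on the carrier.
\<close>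

type_synonym ('a, 'g) cochain2 = "('a \<times> 'a \<Rightarrow> 'g) \<times> ('a \<times> 'a \<Rightarrow> 'g)"

definition cochains2 ::
  "[('a, 'm) lcs_scheme, ('g, 'n) monoid_scheme] \<Rightarrow> ('a, 'g) cochain2 set" where
  "cochains2 A \<Gamma> =
     (carrier A \<times> carrier A \<rightarrow>\<^sub>E carrier \<Gamma>) \<times> (carrier A \<times> carrier A \<rightarrow>\<^sub>E carrier \<Gamma>)"

definition cocycle2 ::
  "[('a, 'm) lcs_scheme, ('g, 'n) monoid_scheme, ('a, 'g) cochain2] \<Rightarrow> bool" where
  "cocycle2 A \<Gamma> = (\<lambda>(f, g). (f, g) \<in> cochains2 A \<Gamma> \<and>
     (\<forall>a\<in>carrier A. \<forall>b\<in>carrier A. \<forall>c\<in>carrier A.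
        g (a, b) = g (b, a) \<and>
        f (a \<otimes>\<^bsub>A\<^esub> b, c) = f (a \<cdot>\<^bsub>A\<^esub> b, a \<cdot>\<^bsub>A\<^esub> c) \<otimes>\<^bsub>\<Gamma>\<^esub> f (a, c) \<and>
        f (a, b \<otimes>\<^bsub>A\<^esub> c) \<otimes>\<^bsub>\<Gamma>\<^esub> inv\<^bsub>\<Gamma>\<^esub> f (a, b) \<otimes>\<^bsub>\<Gamma>\<^esub> inv\<^bsub>\<Gamma>\<^esub> f (a, c) =
          g (a \<cdot>\<^bsub>A\<^esub> b, a \<cdot>\<^bsub>A\<^esub> c) \<otimes>\<^bsub>\<Gamma>\<^esub> inv\<^bsub>\<Gamma>\<^esub> g (b, c) \<and>
        g (a, b) \<otimes>\<^bsub>\<Gamma>\<^esub> g (a \<otimes>\<^bsub>A\<^esub> b, c) = g (b, c) \<otimes>\<^bsub>\<Gamma>\<^esub> g (a, b \<otimes>\<^bsub>A\<^esub> c)))"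

definition normalized2 ::
  "[('a, 'm) lcs_scheme, ('g, 'n) monoid_scheme, ('a, 'g) cochain2] \<Rightarrow> bool" where
  "normalized2 A \<Gamma> = (\<lambda>(f, g). \<forall>a\<in>carrier A.
     f (a, \<one>\<^bsub>A\<^esub>) = \<one>\<^bsub>\<Gamma>\<^esub> \<and> f (\<one>\<^bsub>A\<^esub>, a) = \<one>\<^bsub>\<Gamma>\<^esub> \<and>
     g (a, \<one>\<^bsub>A\<^esub>) = \<one>\<^bsub>\<Gamma>\<^esub> \<and> g (\<one>\<^bsub>A\<^esub>, a) = \<one>\<^bsub>\<Gamma>\<^esub>)"

definition Z2N :: "[('a, 'm) lcs_scheme, ('g, 'n) monoid_scheme] \<Rightarrow> ('a, 'g) cochain2 monoid" where
  "Z2N A \<Gamma> = \<lparr>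
     carrier = {fg. cocycle2 A \<Gamma> fg \<and> normalized2 A \<Gamma> fg},
     mult = (\<lambda>(f, g) (f', g').
       (\<lambda>p\<in>carrier A \<times> carrier A. f p \<otimes>\<^bsub>\<Gamma>\<^esub> f' p, \<lambda>p\<in>carrier A \<times> carrier A. g p \<otimes>\<^bsub>\<Gamma>\<^esub> g' p)),
     one = (\<lambda>p\<in>carrier A \<times> carrier A. \<one>\<^bsub>\<Gamma>\<^esub>, \<lambda>p\<in>carrier A \<times> carrier A. \<one>\<^bsub>\<Gamma>\<^esub>)\<rparr>"

definition coboundary1 ::
  "[('a, 'm) lcs_scheme, ('g, 'n) monoid_scheme, 'a \<Rightarrow> 'g] \<Rightarrow> ('a, 'g) cochain2" where
  "coboundary1 A \<Gamma> \<theta> =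
     (\<lambda>(a, b)\<in>carrier A \<times> carrier A. \<theta> (a \<cdot>\<^bsub>A\<^esub> b) \<otimes>\<^bsub>\<Gamma>\<^esub> inv\<^bsub>\<Gamma>\<^esub> \<theta> b,
      \<lambda>(a, b)\<in>carrier A \<times> carrier A. \<theta> (a \<otimes>\<^bsub>A\<^esub> b) \<otimes>\<^bsub>\<Gamma>\<^esub> inv\<^bsub>\<Gamma>\<^esub> \<theta> a \<otimes>\<^bsub>\<Gamma>\<^esub> inv\<^bsub>\<Gamma>\<^esub> \<theta> b)"

definition B2N :: "[('a, 'm) lcs_scheme, ('g, 'n) monoid_scheme] \<Rightarrow> ('a, 'g) cochain2 set" where
  "B2N A \<Gamma> = {coboundary1 A \<Gamma> \<theta> |\<theta>. \<theta> \<in> carrier A \<rightarrow> carrier \<Gamma> \<and> \<theta> \<one>\<^bsub>A\<^esub> = \<one>\<^bsub>\<Gamma>\<^esub>}"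

definition H2N ::
  "[('a, 'm) lcs_scheme, ('g, 'n) monoid_scheme] \<Rightarrow> ('a, 'g) cochain2 set monoid" where
  "H2N A \<Gamma> = Z2N A \<Gamma> Mod B2N A \<Gamma>"

subsection \<open>The cocycle of an extension\<close>

definition normalized_section ::
  "[('a, 'm) lcs_scheme, ('g, 'e, 'a) extension, 'a \<Rightarrow> 'e] \<Rightarrow> bool" where
  "normalized_section A = (\<lambda>(E, \<iota>, \<pi>) s.
     s \<in> carrier A \<rightarrow> carrier E \<and> (\<forall>a\<in>carrier A. \<pi> (s a) = a) \<and> s \<one>\<^bsub>A\<^esub> = \<one>\<^bsub>E\<^esub>)"

definition section_cochain ::
  "[('a, 'm) lcs_scheme, ('g, 'n) monoid_scheme, ('g, 'e, 'a) extension, 'a \<Rightarrow> 'e,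
    ('a, 'g) cochain2] \<Rightarrow> bool" where
  "section_cochain A \<Gamma> = (\<lambda>(E, \<iota>, \<pi>) s (f, g). (f, g) \<in> cochains2 A \<Gamma> \<and>
     (\<forall>a\<in>carrier A. \<forall>a'\<in>carrier A.
        \<iota> (f (a, a')) = (s a \<cdot>\<^bsub>E\<^esub> s a') \<otimes>\<^bsub>E\<^esub> inv\<^bsub>E\<^esub> s (a \<cdot>\<^bsub>A\<^esub> a') \<and>
        \<iota> (g (a, a')) = s a \<otimes>\<^bsub>E\<^esub> s a' \<otimes>\<^bsub>E\<^esub> inv\<^bsub>E\<^esub> s (a \<otimes>\<^bsub>A\<^esub> a')))"

end

(* A normalized section s identifies E with A x \<Gamma> through (a, u) |-> s a + \<iota> u.  By centrality the
   two operations of E become (a, u) + (b, v) = (a + b, u + v + g(a, b)) and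
   (a, u) . (b, v) = (a . b, v + f(a, b)), so the linear cycle set axioms of E are the cocycle
   identities, and conversely every normalized cocycle defines an extension.  An equivalence of
   extensions has the form (a, u) |-> (a, \<theta> a + u), and compatibility with the operations says
   exactly that \<theta> bounds the difference of the two cocycles. *)

theory Submission
  imports Defs
begin

text \<open>Well-definedness and injectivity are a single statement: two extensions, each with its
  own section and cochain, are equivalent iff the cochains lie in the same coset of
  \<open>B2N\<close>. For one extension with two sections, the identity equivalence turns this into
  independence of the section; for two extensions it shows that the class map respects and separates
  equivalence. Thus \<open>extension_rel\<close> is the kernel relation of the class map, so its
  symmetry and transitivity require no manipulation of isomorphisms, and bijectivity reduces to
  surjectivity of the class map on extensions. The obstacle to surjectivity is that middle terms
  range over a prescribed type. The extension built from a cocycle therefore does not live on pairs: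
  its structure is transported along an injection of
  \<open>carrier A \<times> carrier \<Gamma>\<close> into that type, which the cardinality
  hypothesis supplies. Normalization keeps correction terms away from the neutral element: \<Gamma>
  embeds as the pairs over \<open>\<one>\<close>, and centrality of this copy amounts to
  \<open>f\<close> being trivial when one argument is.\<close>

section \<open>Elementary identities in linear cycle sets\<close>

context linear_cycle_set
begin

lemma cyc_closed [simp, intro]: "a \<in> carrier A \<Longrightarrow> b \<in> carrier A \<Longrightarrow> a \<cdot> b \<in> carrier A"
  using left_translation_bij[of a] by (auto simp: bij_betw_def)

lemma cyc_left_cancel:
  "\<lbrakk>a \<in> carrier A; b \<in> carrier A; c \<in> carrier A\<rbrakk> \<Longrightarrow> a \<cdot> b = a \<cdot> c \<longleftrightarrow> b = c"
  using left_translation_bij[of a] by (auto simp: bij_betw_def inj_on_def)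

lemma cyc_one_right [simp]: "a \<in> carrier A \<Longrightarrow> a \<cdot> \<one> = \<one>"
  using cyc_add_right[of a \<one> \<one>] by simp

text \<open>Since \<open>\<one> \<otimes> \<one> = \<one>\<close>, the second linearity axiom gives
  \<open>\<one> \<cdot> a = \<one> \<cdot> (\<one> \<cdot> a)\<close>, and translation by
  \<open>\<one>\<close> is injective.\<close>

lemma cyc_one_left [simp]:
  assumes "a \<in> carrier A" shows "\<one> \<cdot> a = a"
  using cyc_add_left[of \<one> \<one> a] cyc_left_cancel[of \<one> a "\<one> \<cdot> a"] assms by simp

end

text \<open>The cycle identity is a consequence of the two linearity axioms, since \<open>\<otimes>\<close> is commutative.\<close>

lemma linear_cycle_setI:
  fixes A :: "('a, 'm) lcs_scheme" (structure)
  assumes "comm_group A"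
    and bij: "\<And>b. b \<in> carrier A \<Longrightarrow> bij_betw (\<lambda>a. b \<cdot> a) (carrier A) (carrier A)"
    and right: "\<And>a b c. \<lbrakk>a \<in> carrier A; b \<in> carrier A; c \<in> carrier A\<rbrakk> \<Longrightarrow>
      a \<cdot> (b \<otimes> c) = (a \<cdot> b) \<otimes> (a \<cdot> c)"
    and left: "\<And>a b c. \<lbrakk>a \<in> carrier A; b \<in> carrier A; c \<in> carrier A\<rbrakk> \<Longrightarrow>
      (a \<otimes> b) \<cdot> c = (a \<cdot> b) \<cdot> (a \<cdot> c)"
  shows "linear_cycle_set A"
proof -
  interpret comm_group A by fact
  show ?thesis
  proof
    fix a b c assume "a \<in> carrier A" "b \<in> carrier A" "c \<in> carrier A"
    then show "(a \<cdot> b) \<cdot> (a \<cdot> c) = (b \<cdot> a) \<cdot> (b \<cdot> c)"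
      using left[of a b c] left[of b a c] by (simp add: m_comm)
  qed (use bij right left in auto)
qed

lemma linear_cycle_set_trivial:
  assumes "comm_group \<Gamma>" shows "linear_cycle_set (trivial_lcs \<Gamma>)"
proof -
  interpret comm_group \<Gamma> by fact
  have "comm_group (trivial_lcs \<Gamma>)"
    by (rule comm_groupI) (auto simp: trivial_lcs_def m_ac intro: l_inv_ex)
  then show ?thesis
    by (rule linear_cycle_setI) (auto simp: trivial_lcs_def bij_betw_def)
qed

section \<open>Normalized cocycles and coboundaries\<close>

locale lcs_coeff = linear_cycle_set A + G: comm_group \<Gamma>
  for A :: "('a, 'm) lcs_scheme" (structure) and \<Gamma> :: "('g, 'n) monoid_scheme"
begin

text \<open>Inverses are cleared from the mixed identity, so that every condition equates products
  in \<Gamma> and can be handled by reordering factors.\<close>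

lemma mem_Z2N_iff:
  "(f, g) \<in> carrier (Z2N A \<Gamma>) \<longleftrightarrow>
     f \<in> carrier A \<times> carrier A \<rightarrow>\<^sub>E carrier \<Gamma> \<and> g \<in> carrier A \<times> carrier A \<rightarrow>\<^sub>E carrier \<Gamma> \<and>
     (\<forall>a\<in>carrier A. \<forall>b\<in>carrier A. \<forall>c\<in>carrier A.
        g (a, b) = g (b, a) \<and>
        f (a \<otimes> b, c) = f (a \<cdot> b, a \<cdot> c) \<otimes>\<^bsub>\<Gamma>\<^esub> f (a, c) \<and>
        f (a, b \<otimes> c) \<otimes>\<^bsub>\<Gamma>\<^esub> g (b, c) = f (a, b) \<otimes>\<^bsub>\<Gamma>\<^esub> f (a, c) \<otimes>\<^bsub>\<Gamma>\<^esub> g (a \<cdot> b, a \<cdot> c) \<and>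
        g (a, b) \<otimes>\<^bsub>\<Gamma>\<^esub> g (a \<otimes> b, c) = g (b, c) \<otimes>\<^bsub>\<Gamma>\<^esub> g (a, b \<otimes> c)) \<and>
     (\<forall>a\<in>carrier A. f (a, \<one>) = \<one>\<^bsub>\<Gamma>\<^esub> \<and> f (\<one>, a) = \<one>\<^bsub>\<Gamma>\<^esub> \<and> g (a, \<one>) = \<one>\<^bsub>\<Gamma>\<^esub> \<and> g (\<one>, a) = \<one>\<^bsub>\<Gamma>\<^esub>)"
proof -
  have aux: "x \<otimes>\<^bsub>\<Gamma>\<^esub> inv\<^bsub>\<Gamma>\<^esub> y \<otimes>\<^bsub>\<Gamma>\<^esub> inv\<^bsub>\<Gamma>\<^esub> z = u \<otimes>\<^bsub>\<Gamma>\<^esub> inv\<^bsub>\<Gamma>\<^esub> v \<longleftrightarrow> x \<otimes>\<^bsub>\<Gamma>\<^esub> v = y \<otimes>\<^bsub>\<Gamma>\<^esub> z \<otimes>\<^bsub>\<Gamma>\<^esub> u"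
    if "x \<in> carrier \<Gamma>" "y \<in> carrier \<Gamma>" "z \<in> carrier \<Gamma>" "u \<in> carrier \<Gamma>" "v \<in> carrier \<Gamma>" for x y z u v
    using that
    by (smt (verit, best) G.inv_closed G.inv_solve_left G.inv_solve_right' G.m_assoc G.m_closed G.m_comm)
  show ?thesis
    unfolding Z2N_def cocycle2_def normalized2_def cochains2_def
    by (simp add: PiE_iff aux cong: conj_cong)
qed

text \<open>Symmetry of \<open>g\<close> carries its normalization from the second argument over to
  the first.\<close>

lemma Z2N_I:
  assumes "f \<in> carrier A \<times> carrier A \<rightarrow>\<^sub>E carrier \<Gamma>" "g \<in> carrier A \<times> carrier A \<rightarrow>\<^sub>E carrier \<Gamma>"
    and "\<And>a b. \<lbrakk>a \<in> carrier A; b \<in> carrier A\<rbrakk> \<Longrightarrow> g (a, b) = g (b, a)"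
    and "\<And>a b c. \<lbrakk>a \<in> carrier A; b \<in> carrier A; c \<in> carrier A\<rbrakk> \<Longrightarrow>
      f (a \<otimes> b, c) = f (a \<cdot> b, a \<cdot> c) \<otimes>\<^bsub>\<Gamma>\<^esub> f (a, c)"
    and "\<And>a b c. \<lbrakk>a \<in> carrier A; b \<in> carrier A; c \<in> carrier A\<rbrakk> \<Longrightarrow>
      f (a, b \<otimes> c) \<otimes>\<^bsub>\<Gamma>\<^esub> g (b, c) = f (a, b) \<otimes>\<^bsub>\<Gamma>\<^esub> f (a, c) \<otimes>\<^bsub>\<Gamma>\<^esub> g (a \<cdot> b, a \<cdot> c)"
    and "\<And>a b c. \<lbrakk>a \<in> carrier A; b \<in> carrier A; c \<in> carrier A\<rbrakk> \<Longrightarrow>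
      g (a, b) \<otimes>\<^bsub>\<Gamma>\<^esub> g (a \<otimes> b, c) = g (b, c) \<otimes>\<^bsub>\<Gamma>\<^esub> g (a, b \<otimes> c)"
    and "\<And>a. a \<in> carrier A \<Longrightarrow> f (a, \<one>) = \<one>\<^bsub>\<Gamma>\<^esub>" "\<And>a. a \<in> carrier A \<Longrightarrow> f (\<one>, a) = \<one>\<^bsub>\<Gamma>\<^esub>"
    and "\<And>a. a \<in> carrier A \<Longrightarrow> g (a, \<one>) = \<one>\<^bsub>\<Gamma>\<^esub>"
  shows "(f, g) \<in> carrier (Z2N A \<Gamma>)"
  unfolding mem_Z2N_iff using assms by (metis one_closed)

lemma Z2N_D:
  assumes "(f, g) \<in> carrier (Z2N A \<Gamma>)"
  shows "f \<in> carrier A \<times> carrier A \<rightarrow>\<^sub>E carrier \<Gamma>" "g \<in> carrier A \<times> carrier A \<rightarrow>\<^sub>E carrier \<Gamma>"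
    and "\<And>a b. \<lbrakk>a \<in> carrier A; b \<in> carrier A\<rbrakk> \<Longrightarrow> f (a, b) \<in> carrier \<Gamma>"
    and "\<And>a b. \<lbrakk>a \<in> carrier A; b \<in> carrier A\<rbrakk> \<Longrightarrow> g (a, b) \<in> carrier \<Gamma>"
    and "\<And>a b. \<lbrakk>a \<in> carrier A; b \<in> carrier A\<rbrakk> \<Longrightarrow> g (a, b) = g (b, a)"
    and "\<And>a b c. \<lbrakk>a \<in> carrier A; b \<in> carrier A; c \<in> carrier A\<rbrakk> \<Longrightarrow>
      f (a \<otimes> b, c) = f (a \<cdot> b, a \<cdot> c) \<otimes>\<^bsub>\<Gamma>\<^esub> f (a, c)"
    and "\<And>a b c. \<lbrakk>a \<in> carrier A; b \<in> carrier A; c \<in> carrier A\<rbrakk> \<Longrightarrow>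
      f (a, b \<otimes> c) \<otimes>\<^bsub>\<Gamma>\<^esub> g (b, c) = f (a, b) \<otimes>\<^bsub>\<Gamma>\<^esub> f (a, c) \<otimes>\<^bsub>\<Gamma>\<^esub> g (a \<cdot> b, a \<cdot> c)"
    and "\<And>a b c. \<lbrakk>a \<in> carrier A; b \<in> carrier A; c \<in> carrier A\<rbrakk> \<Longrightarrow>
      g (a, b) \<otimes>\<^bsub>\<Gamma>\<^esub> g (a \<otimes> b, c) = g (b, c) \<otimes>\<^bsub>\<Gamma>\<^esub> g (a, b \<otimes> c)"
    and "\<And>a. a \<in> carrier A \<Longrightarrow> f (a, \<one>) = \<one>\<^bsub>\<Gamma>\<^esub>" "\<And>a. a \<in> carrier A \<Longrightarrow> f (\<one>, a) = \<one>\<^bsub>\<Gamma>\<^esub>"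
    and "\<And>a. a \<in> carrier A \<Longrightarrow> g (a, \<one>) = \<one>\<^bsub>\<Gamma>\<^esub>" "\<And>a. a \<in> carrier A \<Longrightarrow> g (\<one>, a) = \<one>\<^bsub>\<Gamma>\<^esub>"
  using assms unfolding mem_Z2N_iff by blast+

lemma Z2N_mult: "(f, g) \<otimes>\<^bsub>Z2N A \<Gamma>\<^esub> (f', g') =
    (\<lambda>p\<in>carrier A \<times> carrier A. f p \<otimes>\<^bsub>\<Gamma>\<^esub> f' p, \<lambda>p\<in>carrier A \<times> carrier A. g p \<otimes>\<^bsub>\<Gamma>\<^esub> g' p)"
  by (simp add: Z2N_def)

lemma Z2N_one: "\<one>\<^bsub>Z2N A \<Gamma>\<^esub> =
    (\<lambda>p\<in>carrier A \<times> carrier A. \<one>\<^bsub>\<Gamma>\<^esub>, \<lambda>p\<in>carrier A \<times> carrier A. \<one>\<^bsub>\<Gamma>\<^esub>)"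
  by (simp add: Z2N_def)

text \<open>All conditions equate products of values of \<open>f\<close> and \<open>g\<close>; as
  \<Gamma> is commutative, such equations survive pointwise products and pointwise inverses.\<close>

lemma comm_group_Z2N: "comm_group (Z2N A \<Gamma>)"
proof (rule comm_groupI)
  fix x y assume x: "x \<in> carrier (Z2N A \<Gamma>)" and y: "y \<in> carrier (Z2N A \<Gamma>)"
  obtain f g f' g' where xy: "x = (f, g)" "y = (f', g')" by (metis surj_pair)
  \<comment> \<open>The interchange law separates the factors of the two cocycles.\<close>
  have mid: "(p \<otimes>\<^bsub>\<Gamma>\<^esub> q) \<otimes>\<^bsub>\<Gamma>\<^esub> (r \<otimes>\<^bsub>\<Gamma>\<^esub> t) = (p \<otimes>\<^bsub>\<Gamma>\<^esub> r) \<otimes>\<^bsub>\<Gamma>\<^esub> (q \<otimes>\<^bsub>\<Gamma>\<^esub> t)"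
    if "p \<in> carrier \<Gamma>" "q \<in> carrier \<Gamma>" "r \<in> carrier \<Gamma>" "t \<in> carrier \<Gamma>" for p q r t
    using that by (simp add: G.m_ac)
  from x y show "x \<otimes>\<^bsub>Z2N A \<Gamma>\<^esub> y \<in> carrier (Z2N A \<Gamma>)"
    unfolding xy Z2N_mult
  proof (intro Z2N_I, goal_cases)
    case (3 a b)
    then show ?case using Z2N_D(5)[of f g a b] Z2N_D(5)[of f' g' a b] by simp
  next
    case (4 a b c)
    then show ?case
      using Z2N_D(6)[of f g a b c] Z2N_D(6)[of f' g' a b c] by (simp add: Z2N_D mid)
  next
    case (5 a b c)
    then show ?case
      using Z2N_D(7)[of f g a b c] Z2N_D(7)[of f' g' a b c] by (simp add: Z2N_D(3,4) mid)
  next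
    case (6 a b c)
    then show ?case
      using Z2N_D(8)[of f g a b c] Z2N_D(8)[of f' g' a b c]
        mid[of "g (a, b)" "g' (a, b)" "g (a \<otimes> b, c)" "g' (a \<otimes> b, c)"]
        mid[of "g (b, c)" "g' (b, c)" "g (a, b \<otimes> c)" "g' (a, b \<otimes> c)"]
      by (simp add: Z2N_D(3,4))
  qed (auto simp: Z2N_D)
  from x y show "x \<otimes>\<^bsub>Z2N A \<Gamma>\<^esub> y = y \<otimes>\<^bsub>Z2N A \<Gamma>\<^esub> x"
    unfolding xy Z2N_mult mem_Z2N_iff
    by (auto simp: PiE_iff G.m_comm intro!: restrict_ext)
next
  fix x y z assume "x \<in> carrier (Z2N A \<Gamma>)" "y \<in> carrier (Z2N A \<Gamma>)" "z \<in> carrier (Z2N A \<Gamma>)"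
  then show "x \<otimes>\<^bsub>Z2N A \<Gamma>\<^esub> y \<otimes>\<^bsub>Z2N A \<Gamma>\<^esub> z = x \<otimes>\<^bsub>Z2N A \<Gamma>\<^esub> (y \<otimes>\<^bsub>Z2N A \<Gamma>\<^esub> z)"
    by (cases x; cases y; cases z)
       (auto simp: Z2N_mult mem_Z2N_iff PiE_iff G.m_assoc intro!: restrict_ext)
next
  show "\<one>\<^bsub>Z2N A \<Gamma>\<^esub> \<in> carrier (Z2N A \<Gamma>)"
    by (auto simp: Z2N_one mem_Z2N_iff)
next
  fix x assume x: "x \<in> carrier (Z2N A \<Gamma>)"
  obtain f g where fg: "x = (f, g)" by (metis surj_pair)
  from x show "\<one>\<^bsub>Z2N A \<Gamma>\<^esub> \<otimes>\<^bsub>Z2N A \<Gamma>\<^esub> x = x"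
    unfolding fg by (auto simp: Z2N_one Z2N_mult mem_Z2N_iff PiE_iff extensional_def fun_eq_iff)
  define y where "y = (\<lambda>p\<in>carrier A \<times> carrier A. inv\<^bsub>\<Gamma>\<^esub> f p, \<lambda>p\<in>carrier A \<times> carrier A. inv\<^bsub>\<Gamma>\<^esub> g p)"
  have "y \<in> carrier (Z2N A \<Gamma>)"
    using x unfolding fg y_def
  proof (intro Z2N_I, goal_cases)
    case (3 a b)
    then show ?case using Z2N_D(5)[of f g a b] by simp
  next
    case (4 a b c)
    then show ?case using Z2N_D(6)[of f g a b c] by (simp add: Z2N_D(3,4) flip: G.inv_mult)
  next
    case (5 a b c)
    then show ?case using Z2N_D(7)[of f g a b c] by (simp add: Z2N_D(3,4) flip: G.inv_mult)
  next
    case (6 a b c)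
    then show ?case using Z2N_D(8)[of f g a b c] by (simp add: Z2N_D(3,4) flip: G.inv_mult)
  qed (auto simp: Z2N_D)
  moreover have "y \<otimes>\<^bsub>Z2N A \<Gamma>\<^esub> x = \<one>\<^bsub>Z2N A \<Gamma>\<^esub>"
    using x unfolding fg y_def by (auto simp: Z2N_one Z2N_mult mem_Z2N_iff PiE_iff intro!: restrict_ext)
  ultimately show "\<exists>y\<in>carrier (Z2N A \<Gamma>). y \<otimes>\<^bsub>Z2N A \<Gamma>\<^esub> x = \<one>\<^bsub>Z2N A \<Gamma>\<^esub>" by blast
qed

sublocale Z2N: comm_group "Z2N A \<Gamma>" by (rule comm_group_Z2N)

lemma coboundary1_mult:
  assumes "\<theta> \<in> carrier A \<rightarrow> carrier \<Gamma>" "\<theta>' \<in> carrier A \<rightarrow> carrier \<Gamma>"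
  shows "coboundary1 A \<Gamma> \<theta> \<otimes>\<^bsub>Z2N A \<Gamma>\<^esub> coboundary1 A \<Gamma> \<theta>' = coboundary1 A \<Gamma> (\<lambda>a. \<theta> a \<otimes>\<^bsub>\<Gamma>\<^esub> \<theta>' a)"
  using assms unfolding coboundary1_def Z2N_mult
  by (auto simp: Pi_iff G.inv_mult G.m_ac intro!: restrict_ext)

text \<open>The equations on the right are cleared of inverses: in this shape they appear when the
  operations of two extensions are compared in coordinates.\<close>

lemma eq_coboundary1_mult_iff:
  assumes fg: "(f, g) \<in> carrier (Z2N A \<Gamma>)" "(f', g') \<in> carrier (Z2N A \<Gamma>)"
    and \<theta>: "\<theta> \<in> carrier A \<rightarrow> carrier \<Gamma>"
  shows "(f', g') = coboundary1 A \<Gamma> \<theta> \<otimes>\<^bsub>Z2N A \<Gamma>\<^esub> (f, g) \<longleftrightarrow>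
    (\<forall>a\<in>carrier A. \<forall>b\<in>carrier A.
      \<theta> b \<otimes>\<^bsub>\<Gamma>\<^esub> f' (a, b) = \<theta> (a \<cdot> b) \<otimes>\<^bsub>\<Gamma>\<^esub> f (a, b) \<and>
      \<theta> a \<otimes>\<^bsub>\<Gamma>\<^esub> \<theta> b \<otimes>\<^bsub>\<Gamma>\<^esub> g' (a, b) = \<theta> (a \<otimes> b) \<otimes>\<^bsub>\<Gamma>\<^esub> g (a, b))"
proof -
  have [simp]: "a \<in> carrier A \<Longrightarrow> \<theta> a \<in> carrier \<Gamma>" for a using \<theta> by auto
  \<comment> \<open>Cochains are extensional, so equality with a restricted map is decided on its
    domain.\<close>
  have restr: "h = restrict k S \<longleftrightarrow> (\<forall>p\<in>S. h p = k p)" if "h \<in> S \<rightarrow>\<^sub>E carrier \<Gamma>"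
    for h k :: "'a \<times> 'a \<Rightarrow> 'g" and S
    using that by (auto simp: PiE_iff intro: extensionalityI[of h S])
  have aux: "x' = z \<otimes>\<^bsub>\<Gamma>\<^esub> inv\<^bsub>\<Gamma>\<^esub> y \<otimes>\<^bsub>\<Gamma>\<^esub> x \<longleftrightarrow> y \<otimes>\<^bsub>\<Gamma>\<^esub> x' = z \<otimes>\<^bsub>\<Gamma>\<^esub> x"
    if "x \<in> carrier \<Gamma>" "x' \<in> carrier \<Gamma>" "y \<in> carrier \<Gamma>" "z \<in> carrier \<Gamma>" for x x' y z
  proof -
    have "z \<otimes>\<^bsub>\<Gamma>\<^esub> inv\<^bsub>\<Gamma>\<^esub> y \<otimes>\<^bsub>\<Gamma>\<^esub> x = inv\<^bsub>\<Gamma>\<^esub> y \<otimes>\<^bsub>\<Gamma>\<^esub> (z \<otimes>\<^bsub>\<Gamma>\<^esub> x)"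
      using that by (simp add: G.m_ac)
    then show ?thesis using that by (simp add: G.inv_solve_left)
  qed
  have aux': "x' = z \<otimes>\<^bsub>\<Gamma>\<^esub> inv\<^bsub>\<Gamma>\<^esub> y \<otimes>\<^bsub>\<Gamma>\<^esub> inv\<^bsub>\<Gamma>\<^esub> w \<otimes>\<^bsub>\<Gamma>\<^esub> x \<longleftrightarrow> y \<otimes>\<^bsub>\<Gamma>\<^esub> w \<otimes>\<^bsub>\<Gamma>\<^esub> x' = z \<otimes>\<^bsub>\<Gamma>\<^esub> x"
    if "x \<in> carrier \<Gamma>" "x' \<in> carrier \<Gamma>" "y \<in> carrier \<Gamma>" "w \<in> carrier \<Gamma>" "z \<in> carrier \<Gamma>" for x x' y z w
    using aux[of x x' "y \<otimes>\<^bsub>\<Gamma>\<^esub> w" z] that by (simp add: G.inv_mult G.m_assoc)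
  note closed = Z2N_D(3,4)[OF fg(1)] Z2N_D(3,4)[OF fg(2)]
  have "f' (a, b) = \<theta> (a \<cdot> b) \<otimes>\<^bsub>\<Gamma>\<^esub> inv\<^bsub>\<Gamma>\<^esub> \<theta> b \<otimes>\<^bsub>\<Gamma>\<^esub> f (a, b) \<longleftrightarrow>
      \<theta> b \<otimes>\<^bsub>\<Gamma>\<^esub> f' (a, b) = \<theta> (a \<cdot> b) \<otimes>\<^bsub>\<Gamma>\<^esub> f (a, b)"
    and "g' (a, b) = \<theta> (a \<otimes> b) \<otimes>\<^bsub>\<Gamma>\<^esub> inv\<^bsub>\<Gamma>\<^esub> \<theta> a \<otimes>\<^bsub>\<Gamma>\<^esub> inv\<^bsub>\<Gamma>\<^esub> \<theta> b \<otimes>\<^bsub>\<Gamma>\<^esub> g (a, b) \<longleftrightarrow>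
      \<theta> a \<otimes>\<^bsub>\<Gamma>\<^esub> \<theta> b \<otimes>\<^bsub>\<Gamma>\<^esub> g' (a, b) = \<theta> (a \<otimes> b) \<otimes>\<^bsub>\<Gamma>\<^esub> g (a, b)"
    if "a \<in> carrier A" "b \<in> carrier A" for a b
    using that by (intro aux aux'; simp add: closed)+
  then show ?thesis
    unfolding coboundary1_def Z2N_mult prod.inject
      restr[OF Z2N_D(1)[OF fg(2)]] restr[OF Z2N_D(2)[OF fg(2)]]
    by auto
qed

text \<open>The values of \<theta> telescope. What remains is \<open>cyc_add_left\<close> for the
  identity of \<open>f\<close>, \<open>cyc_add_right\<close> for the mixed one, and associativity
  and commutativity of \<open>\<otimes>\<close> for those of \<open>g\<close>.\<close>

lemma coboundary1_mem_Z2N: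
  assumes "\<theta> \<in> carrier A \<rightarrow> carrier \<Gamma>" "\<theta> \<one> = \<one>\<^bsub>\<Gamma>\<^esub>"
  shows "coboundary1 A \<Gamma> \<theta> \<in> carrier (Z2N A \<Gamma>)"
proof -
  have canc: "x \<otimes>\<^bsub>\<Gamma>\<^esub> (inv\<^bsub>\<Gamma>\<^esub> x \<otimes>\<^bsub>\<Gamma>\<^esub> y) = y" "inv\<^bsub>\<Gamma>\<^esub> x \<otimes>\<^bsub>\<Gamma>\<^esub> (x \<otimes>\<^bsub>\<Gamma>\<^esub> y) = y"
    if "x \<in> carrier \<Gamma>" "y \<in> carrier \<Gamma>" for x y
    using that by (simp_all flip: G.m_assoc)
  have [simp]: "a \<in> carrier A \<Longrightarrow> \<theta> a \<in> carrier \<Gamma>" for a using assms by auto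
  show ?thesis
    unfolding coboundary1_def
  proof (rule Z2N_I, goal_cases)
    case (3 a b)
    then show ?case by (simp add: m_comm G.m_ac)
  next
    case (4 a b c)
    then show ?case by (simp add: cyc_add_left G.m_assoc canc)
  next
    case (5 a b c)
    then show ?case by (simp add: cyc_add_right G.m_ac canc)
  next
    case (6 a b c)
    then show ?case by (simp add: m_assoc G.m_ac canc)
  qed (auto simp: assms(2))
qed

lemma subgroup_B2N: "subgroup (B2N A \<Gamma>) (Z2N A \<Gamma>)"
proof (rule Z2N.subgroupI)
  show "B2N A \<Gamma> \<subseteq> carrier (Z2N A \<Gamma>)"
    unfolding B2N_def using coboundary1_mem_Z2N by blast
  have one: "coboundary1 A \<Gamma> (\<lambda>_. \<one>\<^bsub>\<Gamma>\<^esub>) = \<one>\<^bsub>Z2N A \<Gamma>\<^esub>"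
    by (auto simp: coboundary1_def Z2N_one restrict_def)
  have "coboundary1 A \<Gamma> (\<lambda>_. \<one>\<^bsub>\<Gamma>\<^esub>) \<in> B2N A \<Gamma>"
    unfolding B2N_def by (auto simp del: split_paired_Ex)
  then show "B2N A \<Gamma> \<noteq> {}" by blast
  fix x assume "x \<in> B2N A \<Gamma>"
  then obtain \<theta> where \<theta>: "x = coboundary1 A \<Gamma> \<theta>" "\<theta> \<in> carrier A \<rightarrow> carrier \<Gamma>" "\<theta> \<one> = \<one>\<^bsub>\<Gamma>\<^esub>"
    unfolding B2N_def by blast
  \<comment> \<open>Coboundaries depend multiplicatively on \<theta>, so the pointwise inverse of
    \<theta> yields the inverse of \<open>x\<close>.\<close>
  define \<theta>' where "\<theta>' = (\<lambda>a. inv\<^bsub>\<Gamma>\<^esub> \<theta> a)"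
  have \<theta>': "\<theta>' \<in> carrier A \<rightarrow> carrier \<Gamma>" "\<theta>' \<one> = \<one>\<^bsub>\<Gamma>\<^esub>"
    using \<theta> by (auto simp: \<theta>'_def)
  have "coboundary1 A \<Gamma> \<theta>' \<otimes>\<^bsub>Z2N A \<Gamma>\<^esub> x = coboundary1 A \<Gamma> (\<lambda>a. \<theta>' a \<otimes>\<^bsub>\<Gamma>\<^esub> \<theta> a)"
    using \<theta> \<theta>' by (simp add: coboundary1_mult)
  also have "\<dots> = coboundary1 A \<Gamma> (\<lambda>_. \<one>\<^bsub>\<Gamma>\<^esub>)"
    using \<theta> unfolding coboundary1_def by (auto simp: \<theta>'_def Pi_iff intro!: restrict_ext)
  finally have "coboundary1 A \<Gamma> \<theta>' \<otimes>\<^bsub>Z2N A \<Gamma>\<^esub> x = \<one>\<^bsub>Z2N A \<Gamma>\<^esub>" by (simp add: one)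
  then have "inv\<^bsub>Z2N A \<Gamma>\<^esub> x = coboundary1 A \<Gamma> \<theta>'"
    using \<theta> \<theta>' coboundary1_mem_Z2N by (intro Z2N.inv_equality) auto
  then show "inv\<^bsub>Z2N A \<Gamma>\<^esub> x \<in> B2N A \<Gamma>"
    unfolding B2N_def using \<theta>' by auto
  fix y assume "y \<in> B2N A \<Gamma>"
  then obtain \<eta> where "y = coboundary1 A \<Gamma> \<eta>" "\<eta> \<in> carrier A \<rightarrow> carrier \<Gamma>" "\<eta> \<one> = \<one>\<^bsub>\<Gamma>\<^esub>"
    unfolding B2N_def by blast
  with \<theta> show "x \<otimes>\<^bsub>Z2N A \<Gamma>\<^esub> y \<in> B2N A \<Gamma>"
    unfolding B2N_def by (auto simp: coboundary1_mult intro!: exI[of _ "\<lambda>a. \<theta> a \<otimes>\<^bsub>\<Gamma>\<^esub> \<eta> a"])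
qed

text \<open>Equality of classes becomes the existence of one normalized \<theta>, in the orientation
  that \<open>eq_coboundary1_mult_iff\<close> unfolds.\<close>

lemma B2N_coset_eq_iff:
  assumes "x \<in> carrier (Z2N A \<Gamma>)" "y \<in> carrier (Z2N A \<Gamma>)"
  shows "B2N A \<Gamma> #>\<^bsub>Z2N A \<Gamma>\<^esub> x = B2N A \<Gamma> #>\<^bsub>Z2N A \<Gamma>\<^esub> y \<longleftrightarrow>
    (\<exists>\<theta>. \<theta> \<in> carrier A \<rightarrow> carrier \<Gamma> \<and> \<theta> \<one> = \<one>\<^bsub>\<Gamma>\<^esub> \<and> x = coboundary1 A \<Gamma> \<theta> \<otimes>\<^bsub>Z2N A \<Gamma>\<^esub> y)"
proof -
  have "B2N A \<Gamma> #>\<^bsub>Z2N A \<Gamma>\<^esub> x = B2N A \<Gamma> #>\<^bsub>Z2N A \<Gamma>\<^esub> y \<longleftrightarrow> x \<in> B2N A \<Gamma> #>\<^bsub>Z2N A \<Gamma>\<^esub> y"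
    using assms Z2N.repr_independence Z2N.rcos_self subgroup_B2N by metis
  then show ?thesis unfolding r_coset_def B2N_def by (auto simp del: split_paired_Ex)
qed

end

section \<open>Central extensions in the coordinates of a section\<close>

locale central_ext = lcs_coeff A \<Gamma>
  for A :: "('a, 'm) lcs_scheme" (structure) and \<Gamma> :: "('g, 'n) monoid_scheme" +
  fixes E :: "'e lcs" and \<iota> :: "'g \<Rightarrow> 'e" and \<pi> :: "'e \<Rightarrow> 'a"
  assumes ext: "central_extension A \<Gamma> (E, \<iota>, \<pi>)"
begin

sublocale E: linear_cycle_set E
  using ext by (simp add: central_extension_def lcs_short_exact_def)

lemma iota_closed [simp, intro]: "u \<in> carrier \<Gamma> \<Longrightarrow> \<iota> u \<in> carrier E"
  and iota_mult: "u \<in> carrier \<Gamma> \<Longrightarrow> v \<in> carrier \<Gamma> \<Longrightarrow> \<iota> (u \<otimes>\<^bsub>\<Gamma>\<^esub> v) = \<iota> u \<otimes>\<^bsub>E\<^esub> \<iota> v"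
  and iota_inj: "u \<in> carrier \<Gamma> \<Longrightarrow> v \<in> carrier \<Gamma> \<Longrightarrow> \<iota> u = \<iota> v \<longleftrightarrow> u = v"
  and pi_closed [simp, intro]: "x \<in> carrier E \<Longrightarrow> \<pi> x \<in> carrier A"
  and pi_mult: "x \<in> carrier E \<Longrightarrow> y \<in> carrier E \<Longrightarrow> \<pi> (x \<otimes>\<^bsub>E\<^esub> y) = \<pi> x \<otimes> \<pi> y"
  and pi_cyc: "x \<in> carrier E \<Longrightarrow> y \<in> carrier E \<Longrightarrow> \<pi> (x \<cdot>\<^bsub>E\<^esub> y) = \<pi> x \<cdot> \<pi> y"
  and pi_image: "\<pi> ` carrier E = carrier A"
  and iota_image: "\<iota> ` carrier \<Gamma> = kernel E A \<pi>"
  and cyc_iota: "x \<in> carrier E \<Longrightarrow> u \<in> carrier \<Gamma> \<Longrightarrow> x \<cdot>\<^bsub>E\<^esub> \<iota> u = \<iota> u"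
  and iota_cyc: "x \<in> carrier E \<Longrightarrow> u \<in> carrier \<Gamma> \<Longrightarrow> \<iota> u \<cdot>\<^bsub>E\<^esub> x = x"
  using ext
  by (auto simp: central_extension_def lcs_short_exact_def lcs_hom_def hom_def trivial_lcs_def
      central_linear_cycle_subset_def inj_on_def)

lemma iota_one: "\<iota> \<one>\<^bsub>\<Gamma>\<^esub> = \<one>\<^bsub>E\<^esub>"
  using iota_mult[of "\<one>\<^bsub>\<Gamma>\<^esub>" "\<one>\<^bsub>\<Gamma>\<^esub>"] by simp

lemma pi_one: "\<pi> \<one>\<^bsub>E\<^esub> = \<one>"
  using pi_mult[of "\<one>\<^bsub>E\<^esub>" "\<one>\<^bsub>E\<^esub>"] by simp

lemma pi_iota: "u \<in> carrier \<Gamma> \<Longrightarrow> \<pi> (\<iota> u) = \<one>"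
  using iota_image by (auto simp: kernel_def)

lemma normalized_section_exists: "\<exists>s. normalized_section A (E, \<iota>, \<pi>) s"
proof -
  define s where "s = inv_into (carrier E) \<pi>"
  have s: "\<forall>a\<in>carrier A. s a \<in> carrier E \<and> \<pi> (s a) = a"
    unfolding s_def pi_image[symmetric] by (auto intro: inv_into_into f_inv_into_f)
  \<comment> \<open>Any choice of preimages may be corrected at \<open>\<one>\<close>, because
    \<open>\<one>\<close> of \<open>E\<close> lies over it.\<close>
  then have "normalized_section A (E, \<iota>, \<pi>) (s(\<one> := \<one>\<^bsub>E\<^esub>))"
    by (auto simp: normalized_section_def pi_one)
  then show ?thesis by blast
qed

end

locale sectioned_central_ext = central_ext A \<Gamma> E \<iota> \<pi>
  for A :: "('a, 'm) lcs_scheme" (structure) and \<Gamma> :: "('g, 'n) monoid_scheme"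
    and E :: "'e lcs" and \<iota> :: "'g \<Rightarrow> 'e" and \<pi> :: "'e \<Rightarrow> 'a" +
  fixes s :: "'a \<Rightarrow> 'e"
  assumes sec: "normalized_section A (E, \<iota>, \<pi>) s"
begin

lemma s_closed [simp, intro]: "a \<in> carrier A \<Longrightarrow> s a \<in> carrier E"
  and pi_s: "a \<in> carrier A \<Longrightarrow> \<pi> (s a) = a"
  and s_one: "s \<one> = \<one>\<^bsub>E\<^esub>"
  using sec by (auto simp: normalized_section_def)

text \<open>The coordinate map from \<open>carrier A \<times> carrier \<Gamma>\<close> to
  \<open>carrier E\<close>; \<open>pt_eq_iff\<close> and \<open>pt_cases\<close> are its injectivity
  and surjectivity.\<close>

definition pt :: "'a \<Rightarrow> 'g \<Rightarrow> 'e" where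
  "pt a u = s a \<otimes>\<^bsub>E\<^esub> \<iota> u"

lemma pt_closed [simp, intro]: "a \<in> carrier A \<Longrightarrow> u \<in> carrier \<Gamma> \<Longrightarrow> pt a u \<in> carrier E"
  by (simp add: pt_def)

lemma pt_one: "a \<in> carrier A \<Longrightarrow> pt a \<one>\<^bsub>\<Gamma>\<^esub> = s a"
  by (simp add: pt_def iota_one)

lemma one_pt: "u \<in> carrier \<Gamma> \<Longrightarrow> pt \<one> u = \<iota> u"
  by (simp add: pt_def s_one)

lemma pi_pt: "a \<in> carrier A \<Longrightarrow> u \<in> carrier \<Gamma> \<Longrightarrow> \<pi> (pt a u) = a"
  by (simp add: pt_def pi_mult pi_s pi_iota)

lemma pt_iota: "\<lbrakk>a \<in> carrier A; u \<in> carrier \<Gamma>; v \<in> carrier \<Gamma>\<rbrakk> \<Longrightarrow>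
    pt a u \<otimes>\<^bsub>E\<^esub> \<iota> v = pt a (u \<otimes>\<^bsub>\<Gamma>\<^esub> v)"
  by (simp add: pt_def iota_mult E.m_assoc)

lemma pt_eq_iff: "\<lbrakk>a \<in> carrier A; b \<in> carrier A; u \<in> carrier \<Gamma>; v \<in> carrier \<Gamma>\<rbrakk> \<Longrightarrow>
    pt a u = pt b v \<longleftrightarrow> a = b \<and> u = v"
  using pi_pt[of a u] pi_pt[of b v] by (auto simp: pt_def iota_inj)

text \<open>The difference of \<open>x\<close> and \<open>s (\<pi> x)\<close> lies in the kernel of
  \<pi>, which by exactness is the image of \<iota>.\<close>

lemma pt_cases:
  assumes x: "x \<in> carrier E"
  obtains a u where "a \<in> carrier A" "u \<in> carrier \<Gamma>" "x = pt a u"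
proof -
  define a where "a = \<pi> x"
  have a: "a \<in> carrier A" using x by (simp add: a_def)
  have y: "inv\<^bsub>E\<^esub> s a \<otimes>\<^bsub>E\<^esub> x \<in> carrier E" using x a by simp
  have "s a \<otimes>\<^bsub>E\<^esub> (inv\<^bsub>E\<^esub> s a \<otimes>\<^bsub>E\<^esub> x) = x"
    using x a by (simp flip: E.m_assoc)
  moreover from this have "a \<otimes> \<pi> (inv\<^bsub>E\<^esub> s a \<otimes>\<^bsub>E\<^esub> x) = a"
    using pi_mult[OF s_closed[OF a] y] a by (simp add: pi_s a_def)
  then have "inv\<^bsub>E\<^esub> s a \<otimes>\<^bsub>E\<^esub> x \<in> \<iota> ` carrier \<Gamma>"
    using a y unfolding iota_image kernel_def by simp
  ultimately show ?thesis using that a by (auto simp: pt_def)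
qed

text \<open>With \<open>\<iota> u\<close> moved to the front, \<open>cyc_add_left\<close> splits the
  action of \<open>pt a u\<close> into those of \<open>\<iota> u\<close> and \<open>s a\<close>. The
  central element acts trivially, so \<open>u\<close> disappears; on the right,
  \<open>\<iota> v\<close> is fixed by every translation.\<close>

lemma pt_cyc_pt: "\<lbrakk>a \<in> carrier A; b \<in> carrier A; u \<in> carrier \<Gamma>; v \<in> carrier \<Gamma>\<rbrakk> \<Longrightarrow>
    pt a u \<cdot>\<^bsub>E\<^esub> pt b v = (s a \<cdot>\<^bsub>E\<^esub> s b) \<otimes>\<^bsub>E\<^esub> \<iota> v"
  using E.cyc_add_left[of "\<iota> u" "s a" "pt b v"]
  by (simp add: pt_def E.m_comm[of _ "\<iota> u"] E.cyc_add_right cyc_iota iota_cyc)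

lemma pt_mult_pt: "\<lbrakk>a \<in> carrier A; b \<in> carrier A; u \<in> carrier \<Gamma>; v \<in> carrier \<Gamma>\<rbrakk> \<Longrightarrow>
    pt a u \<otimes>\<^bsub>E\<^esub> pt b v = (s a \<otimes>\<^bsub>E\<^esub> s b) \<otimes>\<^bsub>E\<^esub> \<iota> (u \<otimes>\<^bsub>\<Gamma>\<^esub> v)"
  by (simp add: pt_def iota_mult E.m_ac)

text \<open>Solved for the products of section values, the defining equations exhibit
  \<open>f\<close> and \<open>g\<close> as second coordinates, which \<open>pt_eq_iff\<close> can
  compare.\<close>

lemma section_cochain_iff:
  "section_cochain A \<Gamma> (E, \<iota>, \<pi>) s (f, g) \<longleftrightarrow> (f, g) \<in> cochains2 A \<Gamma> \<and>
     (\<forall>a\<in>carrier A. \<forall>b\<in>carrier A.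
        s a \<cdot>\<^bsub>E\<^esub> s b = pt (a \<cdot> b) (f (a, b)) \<and> s a \<otimes>\<^bsub>E\<^esub> s b = pt (a \<otimes> b) (g (a, b)))"
proof -
  have aux: "\<iota> w = x \<otimes>\<^bsub>E\<^esub> inv\<^bsub>E\<^esub> s c \<longleftrightarrow> x = pt c w"
    if "w \<in> carrier \<Gamma>" "x \<in> carrier E" "c \<in> carrier A" for w x c
    using that by (metis E.inv_solve_right E.m_comm iota_closed pt_def s_closed)
  show ?thesis
    by (simp add: section_cochain_def cochains2_def PiE_iff aux cong: conj_cong)
qed

lemma section_cochain_ex1: "\<exists>!fg. section_cochain A \<Gamma> (E, \<iota>, \<pi>) s fg"
proof (rule ex_ex1I)
  \<comment> \<open>Since \<pi> preserves the operation, \<open>s a \<cdot> s b\<close> computed in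
    \<open>E\<close> lies over \<open>a \<cdot> b\<close>; this fixes the first coordinate supplied
    by \<open>pt_cases\<close>.\<close>
  have cyc: "\<exists>u\<in>carrier \<Gamma>. s a \<cdot>\<^bsub>E\<^esub> s b = pt (a \<cdot> b) u"
    if "a \<in> carrier A" "b \<in> carrier A" for a b
    using that pi_cyc[of "s a" "s b"] pi_pt
    by (metis E.cyc_closed pi_s pt_cases s_closed)
  have mult: "\<exists>u\<in>carrier \<Gamma>. s a \<otimes>\<^bsub>E\<^esub> s b = pt (a \<otimes> b) u"
    if "a \<in> carrier A" "b \<in> carrier A" for a b
    using that pi_mult[of "s a" "s b"] pi_pt
    by (metis E.m_closed pi_s pt_cases s_closed)
  define f where "f = (\<lambda>(a, b)\<in>carrier A \<times> carrier A.
    SOME u. u \<in> carrier \<Gamma> \<and> s a \<cdot>\<^bsub>E\<^esub> s b = pt (a \<cdot> b) u)"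
  define g where "g = (\<lambda>(a, b)\<in>carrier A \<times> carrier A.
    SOME u. u \<in> carrier \<Gamma> \<and> s a \<otimes>\<^bsub>E\<^esub> s b = pt (a \<otimes> b) u)"
  have f: "f (a, b) \<in> carrier \<Gamma> \<and> s a \<cdot>\<^bsub>E\<^esub> s b = pt (a \<cdot> b) (f (a, b))"
    if "a \<in> carrier A" "b \<in> carrier A" for a b
    using someI_ex[OF cyc[OF that, unfolded Bex_def]] that by (simp add: f_def)
  have g: "g (a, b) \<in> carrier \<Gamma> \<and> s a \<otimes>\<^bsub>E\<^esub> s b = pt (a \<otimes> b) (g (a, b))"
    if "a \<in> carrier A" "b \<in> carrier A" for a b
    using someI_ex[OF mult[OF that, unfolded Bex_def]] that by (simp add: g_def)
  have "section_cochain A \<Gamma> (E, \<iota>, \<pi>) s (f, g)"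
    unfolding section_cochain_iff cochains2_def
    using f g by (auto simp: PiE_iff) (auto simp: f_def g_def)
  then show "\<exists>fg. section_cochain A \<Gamma> (E, \<iota>, \<pi>) s fg" by blast
next
  fix fg fg'
  assume "section_cochain A \<Gamma> (E, \<iota>, \<pi>) s fg" "section_cochain A \<Gamma> (E, \<iota>, \<pi>) s fg'"
  moreover obtain f g f' g' where fg: "fg = (f, g)" "fg' = (f', g')" by (metis surj_pair)
  ultimately have *: "section_cochain A \<Gamma> (E, \<iota>, \<pi>) s (f, g)"
    "section_cochain A \<Gamma> (E, \<iota>, \<pi>) s (f', g')" by auto
  \<comment> \<open>Injectivity of the coordinates gives agreement on the carrier; extensionality
    then gives equality of the maps.\<close>
  then have "f p = f' p \<and> g p = g' p" if "p \<in> carrier A \<times> carrier A" for p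
    using that unfolding section_cochain_iff cochains2_def
    by (cases p) (force simp: PiE_iff pt_eq_iff)
  moreover have "f \<in> carrier A \<times> carrier A \<rightarrow>\<^sub>E carrier \<Gamma>" "f' \<in> carrier A \<times> carrier A \<rightarrow>\<^sub>E carrier \<Gamma>"
    "g \<in> carrier A \<times> carrier A \<rightarrow>\<^sub>E carrier \<Gamma>" "g' \<in> carrier A \<times> carrier A \<rightarrow>\<^sub>E carrier \<Gamma>"
    using * unfolding section_cochain_iff cochains2_def by auto
  ultimately have "f = f'" "g = g'" by (metis PiE_ext)+
  then show "fg = fg'" by (simp add: fg)
qed

end

locale central_ext_cochain = sectioned_central_ext A \<Gamma> E \<iota> \<pi> s
  for A :: "('a, 'm) lcs_scheme" (structure) and \<Gamma> :: "('g, 'n) monoid_scheme"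
    and E :: "'e lcs" and \<iota> :: "'g \<Rightarrow> 'e" and \<pi> :: "'e \<Rightarrow> 'a" and s :: "'a \<Rightarrow> 'e" +
  fixes f g :: "'a \<times> 'a \<Rightarrow> 'g"
  assumes cochain: "section_cochain A \<Gamma> (E, \<iota>, \<pi>) s (f, g)"
begin

lemma f_closed [simp, intro]: "a \<in> carrier A \<Longrightarrow> b \<in> carrier A \<Longrightarrow> f (a, b) \<in> carrier \<Gamma>"
  and g_closed [simp, intro]: "a \<in> carrier A \<Longrightarrow> b \<in> carrier A \<Longrightarrow> g (a, b) \<in> carrier \<Gamma>"
  and s_cyc: "a \<in> carrier A \<Longrightarrow> b \<in> carrier A \<Longrightarrow> s a \<cdot>\<^bsub>E\<^esub> s b = pt (a \<cdot> b) (f (a, b))"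
  and s_mult: "a \<in> carrier A \<Longrightarrow> b \<in> carrier A \<Longrightarrow> s a \<otimes>\<^bsub>E\<^esub> s b = pt (a \<otimes> b) (g (a, b))"
  using cochain by (auto simp: section_cochain_iff cochains2_def)

lemma pt_cyc: "\<lbrakk>a \<in> carrier A; b \<in> carrier A; u \<in> carrier \<Gamma>; v \<in> carrier \<Gamma>\<rbrakk> \<Longrightarrow>
    pt a u \<cdot>\<^bsub>E\<^esub> pt b v = pt (a \<cdot> b) (v \<otimes>\<^bsub>\<Gamma>\<^esub> f (a, b))"
  by (simp add: pt_cyc_pt s_cyc pt_iota G.m_comm)

lemma pt_mult: "\<lbrakk>a \<in> carrier A; b \<in> carrier A; u \<in> carrier \<Gamma>; v \<in> carrier \<Gamma>\<rbrakk> \<Longrightarrow>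
    pt a u \<otimes>\<^bsub>E\<^esub> pt b v = pt (a \<otimes> b) (u \<otimes>\<^bsub>\<Gamma>\<^esub> v \<otimes>\<^bsub>\<Gamma>\<^esub> g (a, b))"
  by (simp add: pt_mult_pt s_mult pt_iota G.m_comm)

text \<open>The axioms of \<open>E\<close> are evaluated at the section values, written as points
  with trivial second coordinate, so that only values of \<open>f\<close> and \<open>g\<close>
  remain in the second coordinates. Normalization comes from \<open>s_one\<close>.\<close>

lemma cochain_mem_Z2N: "(f, g) \<in> carrier (Z2N A \<Gamma>)"
proof (rule Z2N_I)
  show "f \<in> carrier A \<times> carrier A \<rightarrow>\<^sub>E carrier \<Gamma>" "g \<in> carrier A \<times> carrier A \<rightarrow>\<^sub>E carrier \<Gamma>"
    using cochain by (auto simp: section_cochain_iff cochains2_def)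
  fix a assume a: "a \<in> carrier A"
  \<comment> \<open>Translations of \<open>E\<close> fix its neutral element, and points over
    \<open>\<one>\<close> are values of \<iota>, so \<open>\<iota> (f (a, \<one>))\<close> is
    neutral.\<close>
  show "f (a, \<one>) = \<one>\<^bsub>\<Gamma>\<^esub>"
    using a s_cyc[of a \<one>] iota_inj[of "f (a, \<one>)" "\<one>\<^bsub>\<Gamma>\<^esub>"] by (simp add: s_one one_pt iota_one)
  have "pt a (f (\<one>, a)) = pt a \<one>\<^bsub>\<Gamma>\<^esub>"
    using a s_cyc[of \<one> a] by (simp add: s_one pt_one)
  then show "f (\<one>, a) = \<one>\<^bsub>\<Gamma>\<^esub>" using a by (simp add: pt_eq_iff)
  have "pt a (g (a, \<one>)) = pt a \<one>\<^bsub>\<Gamma>\<^esub>"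
    using a s_mult[of a \<one>] by (simp add: s_one pt_one)
  then show "g (a, \<one>) = \<one>\<^bsub>\<Gamma>\<^esub>" using a by (simp add: pt_eq_iff)
  fix b assume b: "b \<in> carrier A"
  have "pt (a \<otimes> b) (g (a, b)) = pt (a \<otimes> b) (g (b, a))"
    using a b s_mult[of a b] s_mult[of b a] by (metis E.m_comm m_comm s_closed)
  then show "g (a, b) = g (b, a)" using a b by (simp add: pt_eq_iff)
  fix c assume c: "c \<in> carrier A"
  show "f (a \<otimes> b, c) = f (a \<cdot> b, a \<cdot> c) \<otimes>\<^bsub>\<Gamma>\<^esub> f (a, c)"
    using a b c E.cyc_add_left[of "pt a \<one>\<^bsub>\<Gamma>\<^esub>" "pt b \<one>\<^bsub>\<Gamma>\<^esub>" "pt c \<one>\<^bsub>\<Gamma>\<^esub>"]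
    by (simp add: pt_cyc pt_mult pt_eq_iff G.m_comm)
  show "f (a, b \<otimes> c) \<otimes>\<^bsub>\<Gamma>\<^esub> g (b, c) = f (a, b) \<otimes>\<^bsub>\<Gamma>\<^esub> f (a, c) \<otimes>\<^bsub>\<Gamma>\<^esub> g (a \<cdot> b, a \<cdot> c)"
    using a b c E.cyc_add_right[of "pt a \<one>\<^bsub>\<Gamma>\<^esub>" "pt b \<one>\<^bsub>\<Gamma>\<^esub>" "pt c \<one>\<^bsub>\<Gamma>\<^esub>"]
    by (simp add: pt_cyc pt_mult pt_eq_iff G.m_comm)
  show "g (a, b) \<otimes>\<^bsub>\<Gamma>\<^esub> g (a \<otimes> b, c) = g (b, c) \<otimes>\<^bsub>\<Gamma>\<^esub> g (a, b \<otimes> c)"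
    using a b c E.m_assoc[of "pt a \<one>\<^bsub>\<Gamma>\<^esub>" "pt b \<one>\<^bsub>\<Gamma>\<^esub>" "pt c \<one>\<^bsub>\<Gamma>\<^esub>"]
    by (simp add: pt_mult pt_eq_iff)
qed

end

section \<open>Equivalences of extensions and coboundaries\<close>

text \<open>The two extensions may coincide while their sections differ; this case later gives
  independence of the section.\<close>

locale central_ext_cochain_pair =
  X: central_ext_cochain A \<Gamma> E \<iota> \<pi> s f g + Y: central_ext_cochain A \<Gamma> E' \<iota>' \<pi>' s' f' g'
  for A :: "('a, 'm) lcs_scheme" (structure) and \<Gamma> :: "('g, 'n) monoid_scheme"
    and E :: "'e lcs" and \<iota> \<pi> s f g and E' :: "'f lcs" and \<iota>' \<pi>' s' f' g'
begin

lemma coboundary_of_equiv: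
  assumes "extension_equiv \<Gamma> (E, \<iota>, \<pi>) (E', \<iota>', \<pi>')"
  obtains \<theta> where "\<theta> \<in> carrier A \<rightarrow> carrier \<Gamma>" "\<theta> \<one> = \<one>\<^bsub>\<Gamma>\<^esub>"
    "(f', g') = coboundary1 A \<Gamma> \<theta> \<otimes>\<^bsub>Z2N A \<Gamma>\<^esub> (f, g)"
proof -
  obtain \<phi> where \<phi>: "\<phi> \<in> lcs_iso E E'" and \<iota>: "\<And>u. u \<in> carrier \<Gamma> \<Longrightarrow> \<phi> (\<iota> u) = \<iota>' u"
    and \<pi>: "\<And>x. x \<in> carrier E \<Longrightarrow> \<pi>' (\<phi> x) = \<pi> x"
    using assms by (auto simp: extension_equiv_def)
  have closed: "\<And>x. x \<in> carrier E \<Longrightarrow> \<phi> x \<in> carrier E'"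
    and mult: "\<And>x y. x \<in> carrier E \<Longrightarrow> y \<in> carrier E \<Longrightarrow> \<phi> (x \<otimes>\<^bsub>E\<^esub> y) = \<phi> x \<otimes>\<^bsub>E'\<^esub> \<phi> y"
    and cyc: "\<And>x y. x \<in> carrier E \<Longrightarrow> y \<in> carrier E \<Longrightarrow> \<phi> (x \<cdot>\<^bsub>E\<^esub> y) = \<phi> x \<cdot>\<^bsub>E'\<^esub> \<phi> y"
    using \<phi> by (auto simp: lcs_iso_def lcs_hom_def hom_def)
  \<comment> \<open>As \<phi> commutes with the projections, \<open>\<phi> (s a)\<close> lies over
    \<open>a\<close>. It differs from \<open>s' a\<close> by an element of the image of
    \<open>\<iota>'\<close>, and \<open>\<theta> a\<close> is that difference.\<close>
  have "\<exists>u\<in>carrier \<Gamma>. \<phi> (s a) = Y.pt a u" if "a \<in> carrier A" for a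
    using Y.pt_cases[OF closed[OF X.s_closed[OF that]]] Y.pi_pt \<pi> X.pi_s that X.s_closed by metis
  then obtain \<theta> where \<theta>: "\<And>a. a \<in> carrier A \<Longrightarrow> \<theta> a \<in> carrier \<Gamma>"
    "\<And>a. a \<in> carrier A \<Longrightarrow> \<phi> (s a) = Y.pt a (\<theta> a)" by metis
  have \<phi>_pt: "\<phi> (X.pt a u) = Y.pt a (\<theta> a \<otimes>\<^bsub>\<Gamma>\<^esub> u)" if "a \<in> carrier A" "u \<in> carrier \<Gamma>" for a u
    using that \<theta> by (simp add: X.pt_def mult \<iota> Y.pt_iota)
  \<comment> \<open>Both sides are the image under \<phi> of the neutral element, once as
    \<open>s \<one>\<close> and once as a value of \<iota>.\<close>
  have "\<iota>' (\<theta> \<one>) = \<iota>' \<one>\<^bsub>\<Gamma>\<^esub>"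
    using \<theta>[of \<one>] \<iota>[of "\<one>\<^bsub>\<Gamma>\<^esub>"] by (simp add: X.s_one X.iota_one Y.one_pt)
  then have one: "\<theta> \<one> = \<one>\<^bsub>\<Gamma>\<^esub>" using \<theta> by (simp add: Y.iota_inj)
  have f: "\<theta> b \<otimes>\<^bsub>\<Gamma>\<^esub> f' (a, b) = \<theta> (a \<cdot> b) \<otimes>\<^bsub>\<Gamma>\<^esub> f (a, b)" if "a \<in> carrier A" "b \<in> carrier A" for a b
    using that cyc[of "s a" "s b"] by (simp add: \<theta> X.s_cyc \<phi>_pt Y.pt_cyc Y.pt_eq_iff)
  have g: "\<theta> a \<otimes>\<^bsub>\<Gamma>\<^esub> \<theta> b \<otimes>\<^bsub>\<Gamma>\<^esub> g' (a, b) = \<theta> (a \<otimes> b) \<otimes>\<^bsub>\<Gamma>\<^esub> g (a, b)" if "a \<in> carrier A" "b \<in> carrier A" for a b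
    using that mult[of "s a" "s b"] by (simp add: \<theta> X.s_mult \<phi>_pt Y.pt_mult Y.pt_eq_iff)
  show ?thesis
    using that[of \<theta>] \<theta>(1) one f g
      X.eq_coboundary1_mult_iff[OF X.cochain_mem_Z2N Y.cochain_mem_Z2N, of \<theta>] by (simp add: Pi_iff)
qed

lemma equiv_of_coboundary:
  assumes \<theta>: "\<theta> \<in> carrier A \<rightarrow> carrier \<Gamma>" "\<theta> \<one> = \<one>\<^bsub>\<Gamma>\<^esub>"
    and fg: "(f', g') = coboundary1 A \<Gamma> \<theta> \<otimes>\<^bsub>Z2N A \<Gamma>\<^esub> (f, g)"
  shows "extension_equiv \<Gamma> (E, \<iota>, \<pi>) (E', \<iota>', \<pi>')"
proof -
  have [simp]: "a \<in> carrier A \<Longrightarrow> \<theta> a \<in> carrier \<Gamma>" for a using \<theta> by auto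
  have f: "\<theta> b \<otimes>\<^bsub>\<Gamma>\<^esub> f' (a, b) = \<theta> (a \<cdot> b) \<otimes>\<^bsub>\<Gamma>\<^esub> f (a, b)"
    and g: "\<theta> a \<otimes>\<^bsub>\<Gamma>\<^esub> \<theta> b \<otimes>\<^bsub>\<Gamma>\<^esub> g' (a, b) = \<theta> (a \<otimes> b) \<otimes>\<^bsub>\<Gamma>\<^esub> g (a, b)"
    if "a \<in> carrier A" "b \<in> carrier A" for a b
    using fg that X.eq_coboundary1_mult_iff[OF X.cochain_mem_Z2N Y.cochain_mem_Z2N \<theta>(1)] by blast+
  \<comment> \<open>The shift by \<theta> in coordinates; the description is unique because a point
    determines its coordinates.\<close>
  define \<phi> where "\<phi> x = (THE y. \<exists>a\<in>carrier A. \<exists>u\<in>carrier \<Gamma>. x = X.pt a u \<and> y = Y.pt a (\<theta> a \<otimes>\<^bsub>\<Gamma>\<^esub> u))" for x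
  have \<phi>: "\<phi> (X.pt a u) = Y.pt a (\<theta> a \<otimes>\<^bsub>\<Gamma>\<^esub> u)" if "a \<in> carrier A" "u \<in> carrier \<Gamma>" for a u
    unfolding \<phi>_def using that by (intro the_equality) (auto simp: X.pt_eq_iff)
  have "\<phi> \<in> lcs_hom E E'"
    unfolding lcs_hom_def hom_def
  proof (intro CollectI conjI Pi_I ballI)
    fix x y assume "x \<in> carrier E" "y \<in> carrier E"
    then obtain a u b v where *: "a \<in> carrier A" "u \<in> carrier \<Gamma>" "x = X.pt a u"
      "b \<in> carrier A" "v \<in> carrier \<Gamma>" "y = X.pt b v"
      by (metis X.pt_cases)
    then show "\<phi> x \<in> carrier E'" by (simp add: \<phi>)
    \<comment> \<open>The regrouping produces the product
      \<open>\<theta> b \<otimes> f' (a, b)\<close> in \<Gamma>, to which the coboundary equation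
      applies.\<close>
    have "\<theta> b \<otimes>\<^bsub>\<Gamma>\<^esub> v \<otimes>\<^bsub>\<Gamma>\<^esub> f' (a, b) = (\<theta> b \<otimes>\<^bsub>\<Gamma>\<^esub> f' (a, b)) \<otimes>\<^bsub>\<Gamma>\<^esub> v"
      using * by (simp add: X.G.m_ac)
    then show "\<phi> (x \<cdot>\<^bsub>E\<^esub> y) = \<phi> x \<cdot>\<^bsub>E'\<^esub> \<phi> y"
      using * by (simp add: \<phi> X.pt_cyc Y.pt_cyc Y.pt_eq_iff f) (simp add: X.G.m_ac)
    have "\<theta> a \<otimes>\<^bsub>\<Gamma>\<^esub> u \<otimes>\<^bsub>\<Gamma>\<^esub> (\<theta> b \<otimes>\<^bsub>\<Gamma>\<^esub> v) \<otimes>\<^bsub>\<Gamma>\<^esub> g' (a, b)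
        = (\<theta> a \<otimes>\<^bsub>\<Gamma>\<^esub> \<theta> b \<otimes>\<^bsub>\<Gamma>\<^esub> g' (a, b)) \<otimes>\<^bsub>\<Gamma>\<^esub> (u \<otimes>\<^bsub>\<Gamma>\<^esub> v)"
      using * by (simp add: X.G.m_ac)
    then show "\<phi> (x \<otimes>\<^bsub>E\<^esub> y) = \<phi> x \<otimes>\<^bsub>E'\<^esub> \<phi> y"
      using * by (simp add: \<phi> X.pt_mult Y.pt_mult Y.pt_eq_iff g) (simp add: X.G.m_ac)
  qed
  moreover have "bij_betw \<phi> (carrier E) (carrier E')"
    unfolding bij_betw_def
  proof (intro conjI inj_onI equalityI subsetI)
    fix x y assume "x \<in> carrier E" "y \<in> carrier E" "\<phi> x = \<phi> y"
    then show "x = y"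
      by (elim X.pt_cases) (auto simp: \<phi> Y.pt_eq_iff)
  next
    fix y assume "y \<in> \<phi> ` carrier E"
    then show "y \<in> carrier E'" by (auto elim!: X.pt_cases simp: \<phi>)
  next
    fix y assume "y \<in> carrier E'"
    then obtain a u where *: "a \<in> carrier A" "u \<in> carrier \<Gamma>" "y = Y.pt a u" by (rule Y.pt_cases)
    show "y \<in> \<phi> ` carrier E"
    proof (rule image_eqI)
      \<comment> \<open>The preimage undoes the shift by \<open>\<theta> a\<close>.\<close>
      show "y = \<phi> (X.pt a (inv\<^bsub>\<Gamma>\<^esub> \<theta> a \<otimes>\<^bsub>\<Gamma>\<^esub> u))"
        using * by (simp add: \<phi> flip: X.G.m_assoc)
      show "X.pt a (inv\<^bsub>\<Gamma>\<^esub> \<theta> a \<otimes>\<^bsub>\<Gamma>\<^esub> u) \<in> carrier E"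
        using * by simp
    qed
  qed
  moreover have "\<phi> (\<iota> u) = \<iota>' u" if "u \<in> carrier \<Gamma>" for u
    using that \<phi>[of \<one> u] by (simp add: X.one_pt Y.one_pt \<theta>)
  moreover have "\<pi>' (\<phi> x) = \<pi> x" if "x \<in> carrier E" for x
    using that by (elim X.pt_cases) (simp add: \<phi> X.pi_pt Y.pi_pt)
  ultimately show ?thesis unfolding extension_equiv_def lcs_iso_def by blast
qed

lemma equiv_iff_coset_eq:
  "extension_equiv \<Gamma> (E, \<iota>, \<pi>) (E', \<iota>', \<pi>') \<longleftrightarrow>
     B2N A \<Gamma> #>\<^bsub>Z2N A \<Gamma>\<^esub> (f, g) = B2N A \<Gamma> #>\<^bsub>Z2N A \<Gamma>\<^esub> (f', g')"
proof -
  have "extension_equiv \<Gamma> (E, \<iota>, \<pi>) (E', \<iota>', \<pi>') \<longleftrightarrow>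
      (\<exists>\<theta>. \<theta> \<in> carrier A \<rightarrow> carrier \<Gamma> \<and> \<theta> \<one> = \<one>\<^bsub>\<Gamma>\<^esub> \<and>
        (f', g') = coboundary1 A \<Gamma> \<theta> \<otimes>\<^bsub>Z2N A \<Gamma>\<^esub> (f, g))"
    using coboundary_of_equiv equiv_of_coboundary by blast
  then show ?thesis
    using X.B2N_coset_eq_iff[OF Y.cochain_mem_Z2N X.cochain_mem_Z2N] by auto
qed

end

section \<open>The extension defined by a cocycle\<close>

text \<open>The injection \<open>h\<close> names the pairs inside the prescribed type;
  \<open>coord\<close> reads a pair back from its name.\<close>

locale twisted_product = lcs_coeff A \<Gamma>
  for A :: "('a, 'm) lcs_scheme" (structure) and \<Gamma> :: "('g, 'n) monoid_scheme" +
  fixes f g :: "'a \<times> 'a \<Rightarrow> 'g" and h :: "'a \<times> 'g \<Rightarrow> 'e"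
  assumes fg: "(f, g) \<in> carrier (Z2N A \<Gamma>)"
    and inj: "inj_on h (carrier A \<times> carrier \<Gamma>)"
begin

definition coord :: "'e \<Rightarrow> 'a \<times> 'g" where
  "coord = inv_into (carrier A \<times> carrier \<Gamma>) h"

text \<open>The formulas are those which \<open>pt_mult\<close> and \<open>pt_cyc\<close> force on
  every extension with cocycle \<open>(f, g)\<close>.\<close>

definition E :: "'e lcs" where
  "E = \<lparr>carrier = h ` (carrier A \<times> carrier \<Gamma>),
    mult = (\<lambda>x y. case (coord x, coord y) of ((a, u), (b, v)) \<Rightarrow>
      h (a \<otimes> b, u \<otimes>\<^bsub>\<Gamma>\<^esub> v \<otimes>\<^bsub>\<Gamma>\<^esub> g (a, b))),
    one = h (\<one>, \<one>\<^bsub>\<Gamma>\<^esub>),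
    cyc = (\<lambda>x y. case (coord x, coord y) of ((a, u), (b, v)) \<Rightarrow>
      h (a \<cdot> b, v \<otimes>\<^bsub>\<Gamma>\<^esub> f (a, b)))\<rparr>"

abbreviation \<iota> :: "'g \<Rightarrow> 'e" where "\<iota> u \<equiv> h (\<one>, u)"
abbreviation \<pi> :: "'e \<Rightarrow> 'a" where "\<pi> x \<equiv> fst (coord x)"
abbreviation s :: "'a \<Rightarrow> 'e" where "s a \<equiv> h (a, \<one>\<^bsub>\<Gamma>\<^esub>)"

lemmas cocycle_closed [simp, intro] = Z2N_D(3,4)[OF fg]
lemmas cocycle_norm [simp] = Z2N_D(9-12)[OF fg]

lemma coord_h [simp]: "a \<in> carrier A \<Longrightarrow> u \<in> carrier \<Gamma> \<Longrightarrow> coord (h (a, u)) = (a, u)"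
  using inj by (simp add: coord_def)

lemma h_eq_iff [simp]: "\<lbrakk>a \<in> carrier A; b \<in> carrier A; u \<in> carrier \<Gamma>; v \<in> carrier \<Gamma>\<rbrakk> \<Longrightarrow>
    h (a, u) = h (b, v) \<longleftrightarrow> a = b \<and> u = v"
  using inj by (auto simp: inj_on_def)

lemma carrier_E: "carrier E = h ` (carrier A \<times> carrier \<Gamma>)"
  and one_E: "\<one>\<^bsub>E\<^esub> = h (\<one>, \<one>\<^bsub>\<Gamma>\<^esub>)"
  by (simp_all add: E_def)

lemma h_mem_E [simp, intro]: "a \<in> carrier A \<Longrightarrow> u \<in> carrier \<Gamma> \<Longrightarrow> h (a, u) \<in> carrier E"
  by (simp add: carrier_E)

lemma E_cases:
  assumes "x \<in> carrier E"
  obtains a u where "a \<in> carrier A" "u \<in> carrier \<Gamma>" "x = h (a, u)"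
  using assms by (auto simp: carrier_E)

lemma mult_E [simp]: "\<lbrakk>a \<in> carrier A; b \<in> carrier A; u \<in> carrier \<Gamma>; v \<in> carrier \<Gamma>\<rbrakk> \<Longrightarrow>
    h (a, u) \<otimes>\<^bsub>E\<^esub> h (b, v) = h (a \<otimes> b, u \<otimes>\<^bsub>\<Gamma>\<^esub> v \<otimes>\<^bsub>\<Gamma>\<^esub> g (a, b))"
  and cyc_E [simp]: "\<lbrakk>a \<in> carrier A; b \<in> carrier A; u \<in> carrier \<Gamma>; v \<in> carrier \<Gamma>\<rbrakk> \<Longrightarrow>
    h (a, u) \<cdot>\<^bsub>E\<^esub> h (b, v) = h (a \<cdot> b, v \<otimes>\<^bsub>\<Gamma>\<^esub> f (a, b))"
  by (simp_all add: E_def)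

lemma comm_group_E: "comm_group E"
proof (rule comm_groupI)
  fix x y assume "x \<in> carrier E" "y \<in> carrier E"
  then obtain a u b v where x: "a \<in> carrier A" "u \<in> carrier \<Gamma>" "x = h (a, u)"
    and y: "b \<in> carrier A" "v \<in> carrier \<Gamma>" "y = h (b, v)"
    by (auto elim!: E_cases)
  then show "x \<otimes>\<^bsub>E\<^esub> y \<in> carrier E" by simp
  have "g (a, b) = g (b, a)" using x y by (intro Z2N_D(5)[OF fg])
  with x y show "x \<otimes>\<^bsub>E\<^esub> y = y \<otimes>\<^bsub>E\<^esub> x" by (simp add: m_comm G.m_comm)
  fix z assume "z \<in> carrier E"
  then obtain c w where z: "c \<in> carrier A" "w \<in> carrier \<Gamma>" "z = h (c, w)" by (rule E_cases)
  \<comment> \<open>Both factors from \<open>g\<close> are brought together so that its cocycle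
    identity can exchange them.\<close>
  have "u \<otimes>\<^bsub>\<Gamma>\<^esub> v \<otimes>\<^bsub>\<Gamma>\<^esub> g (a, b) \<otimes>\<^bsub>\<Gamma>\<^esub> w \<otimes>\<^bsub>\<Gamma>\<^esub> g (a \<otimes> b, c)
      = u \<otimes>\<^bsub>\<Gamma>\<^esub> v \<otimes>\<^bsub>\<Gamma>\<^esub> w \<otimes>\<^bsub>\<Gamma>\<^esub> (g (a, b) \<otimes>\<^bsub>\<Gamma>\<^esub> g (a \<otimes> b, c))"
    using x y z by (simp add: G.m_ac)
  also have "g (a, b) \<otimes>\<^bsub>\<Gamma>\<^esub> g (a \<otimes> b, c) = g (b, c) \<otimes>\<^bsub>\<Gamma>\<^esub> g (a, b \<otimes> c)"
    using x y z by (intro Z2N_D(8)[OF fg])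
  also have "u \<otimes>\<^bsub>\<Gamma>\<^esub> v \<otimes>\<^bsub>\<Gamma>\<^esub> w \<otimes>\<^bsub>\<Gamma>\<^esub> (g (b, c) \<otimes>\<^bsub>\<Gamma>\<^esub> g (a, b \<otimes> c))
      = u \<otimes>\<^bsub>\<Gamma>\<^esub> (v \<otimes>\<^bsub>\<Gamma>\<^esub> w \<otimes>\<^bsub>\<Gamma>\<^esub> g (b, c)) \<otimes>\<^bsub>\<Gamma>\<^esub> g (a, b \<otimes> c)"
    using x y z by (simp add: G.m_ac)
  finally show "x \<otimes>\<^bsub>E\<^esub> y \<otimes>\<^bsub>E\<^esub> z = x \<otimes>\<^bsub>E\<^esub> (y \<otimes>\<^bsub>E\<^esub> z)"
    using x y z by (simp add: m_assoc)
next
  fix x assume "x \<in> carrier E"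
  then obtain a u where x: "a \<in> carrier A" "u \<in> carrier \<Gamma>" "x = h (a, u)" by (rule E_cases)
  then show "\<one>\<^bsub>E\<^esub> \<otimes>\<^bsub>E\<^esub> x = x" by (simp add: one_E)
  \<comment> \<open>An inverse of \<open>x\<close> must lie over \<open>inv a\<close>; its second
    coordinate has to cancel both \<open>u\<close> and the twist
    \<open>g (inv a, a)\<close>.\<close>
  have "inv\<^bsub>\<Gamma>\<^esub> (u \<otimes>\<^bsub>\<Gamma>\<^esub> g (inv a, a)) \<otimes>\<^bsub>\<Gamma>\<^esub> u \<otimes>\<^bsub>\<Gamma>\<^esub> g (inv a, a) = \<one>\<^bsub>\<Gamma>\<^esub>"
    using x by (simp add: G.m_assoc)
  then have "h (inv a, inv\<^bsub>\<Gamma>\<^esub> (u \<otimes>\<^bsub>\<Gamma>\<^esub> g (inv a, a))) \<otimes>\<^bsub>E\<^esub> x = \<one>\<^bsub>E\<^esub>"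
    using x by (simp add: one_E)
  then show "\<exists>y\<in>carrier E. y \<otimes>\<^bsub>E\<^esub> x = \<one>\<^bsub>E\<^esub>"
    by (rule bexI) (use x in simp)
qed (simp add: one_E)

lemma linear_cycle_set_E: "linear_cycle_set E"
proof (rule linear_cycle_setI[OF comm_group_E])
  fix x assume "x \<in> carrier E"
  then obtain a u where x: "a \<in> carrier A" "u \<in> carrier \<Gamma>" "x = h (a, u)" by (rule E_cases)
  show "bij_betw (\<lambda>y. x \<cdot>\<^bsub>E\<^esub> y) (carrier E) (carrier E)"
    unfolding bij_betw_def
  proof (intro conjI inj_onI equalityI subsetI)
    fix y z assume "y \<in> carrier E" "z \<in> carrier E" "x \<cdot>\<^bsub>E\<^esub> y = x \<cdot>\<^bsub>E\<^esub> z"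
    then show "y = z"
      using x by (elim E_cases) (auto simp: cyc_left_cancel)
  next
    fix y assume "y \<in> (\<lambda>y. x \<cdot>\<^bsub>E\<^esub> y) ` carrier E"
    then show "y \<in> carrier E" using x by (auto elim!: E_cases)
  next
    fix y assume "y \<in> carrier E"
    then obtain b v where y: "b \<in> carrier A" "v \<in> carrier \<Gamma>" "y = h (b, v)" by (rule E_cases)
    then have "b \<in> (\<lambda>c. a \<cdot> c) ` carrier A"
      using left_translation_bij[OF x(1)] by (simp add: bij_betw_def)
    then obtain c where c: "c \<in> carrier A" "a \<cdot> c = b" by auto
    show "y \<in> (\<lambda>y. x \<cdot>\<^bsub>E\<^esub> y) ` carrier E"
    proof (rule image_eqI)
      \<comment> \<open>The first coordinate solves \<open>a \<cdot> c = b\<close>; the second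
        compensates the term \<open>f (a, c)\<close> added by the translation.\<close>
      show "y = x \<cdot>\<^bsub>E\<^esub> h (c, v \<otimes>\<^bsub>\<Gamma>\<^esub> inv\<^bsub>\<Gamma>\<^esub> f (a, c))"
        using x y c by (simp add: G.m_assoc)
      show "h (c, v \<otimes>\<^bsub>\<Gamma>\<^esub> inv\<^bsub>\<Gamma>\<^esub> f (a, c)) \<in> carrier E"
        using x y c by simp
    qed
  qed
  fix y z assume "y \<in> carrier E" "z \<in> carrier E"
  then obtain b v c w where y: "b \<in> carrier A" "v \<in> carrier \<Gamma>" "y = h (b, v)"
    and z: "c \<in> carrier A" "w \<in> carrier \<Gamma>" "z = h (c, w)"
    by (auto elim!: E_cases)
  \<comment> \<open>Isolates the left side of the mixed identity, the only one linking
    \<open>f\<close> and \<open>g\<close>.\<close>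
  have "v \<otimes>\<^bsub>\<Gamma>\<^esub> w \<otimes>\<^bsub>\<Gamma>\<^esub> g (b, c) \<otimes>\<^bsub>\<Gamma>\<^esub> f (a, b \<otimes> c) = v \<otimes>\<^bsub>\<Gamma>\<^esub> w \<otimes>\<^bsub>\<Gamma>\<^esub> (f (a, b \<otimes> c) \<otimes>\<^bsub>\<Gamma>\<^esub> g (b, c))"
    using x y z by (simp add: G.m_ac)
  also have "f (a, b \<otimes> c) \<otimes>\<^bsub>\<Gamma>\<^esub> g (b, c) = f (a, b) \<otimes>\<^bsub>\<Gamma>\<^esub> f (a, c) \<otimes>\<^bsub>\<Gamma>\<^esub> g (a \<cdot> b, a \<cdot> c)"
    using x y z by (intro Z2N_D(7)[OF fg])
  also have "v \<otimes>\<^bsub>\<Gamma>\<^esub> w \<otimes>\<^bsub>\<Gamma>\<^esub> (f (a, b) \<otimes>\<^bsub>\<Gamma>\<^esub> f (a, c) \<otimes>\<^bsub>\<Gamma>\<^esub> g (a \<cdot> b, a \<cdot> c))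
      = v \<otimes>\<^bsub>\<Gamma>\<^esub> f (a, b) \<otimes>\<^bsub>\<Gamma>\<^esub> (w \<otimes>\<^bsub>\<Gamma>\<^esub> f (a, c)) \<otimes>\<^bsub>\<Gamma>\<^esub> g (a \<cdot> b, a \<cdot> c)"
    using x y z by (simp add: G.m_ac)
  finally show "x \<cdot>\<^bsub>E\<^esub> (y \<otimes>\<^bsub>E\<^esub> z) = (x \<cdot>\<^bsub>E\<^esub> y) \<otimes>\<^bsub>E\<^esub> (x \<cdot>\<^bsub>E\<^esub> z)"
    using x y z by (simp add: cyc_add_right)
  have "f (a \<otimes> b, c) = f (a \<cdot> b, a \<cdot> c) \<otimes>\<^bsub>\<Gamma>\<^esub> f (a, c)"
    using x y z by (intro Z2N_D(6)[OF fg])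
  then show "(x \<otimes>\<^bsub>E\<^esub> y) \<cdot>\<^bsub>E\<^esub> z = (x \<cdot>\<^bsub>E\<^esub> y) \<cdot>\<^bsub>E\<^esub> (x \<cdot>\<^bsub>E\<^esub> z)"
    using x y z by (simp add: cyc_add_left G.m_ac)
qed

lemma iota_hom: "\<iota> \<in> lcs_hom (trivial_lcs \<Gamma>) E"
  by (auto simp: lcs_hom_def hom_def trivial_lcs_def)

lemma pi_hom: "\<pi> \<in> lcs_hom E A"
  unfolding lcs_hom_def hom_def by (auto elim!: E_cases)

lemma iota_image: "\<iota> ` carrier \<Gamma> = kernel E A \<pi>"
  unfolding kernel_def by (auto elim!: E_cases)

lemma pi_image: "\<pi> ` carrier E = carrier A"
proof (intro equalityI subsetI)
  fix a assume "a \<in> carrier A"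
  then show "a \<in> \<pi> ` carrier E" by (intro image_eqI[of _ _ "s a"]) auto
qed (auto elim!: E_cases)

lemma linear_cycle_set_iota_image: "linear_cycle_set (E\<lparr>carrier := \<iota> ` carrier \<Gamma>\<rparr>)"
proof (rule linear_cycle_setI)
  show "comm_group (E\<lparr>carrier := \<iota> ` carrier \<Gamma>\<rparr>)"
  proof (rule comm_groupI)
    fix x assume "x \<in> carrier (E\<lparr>carrier := \<iota> ` carrier \<Gamma>\<rparr>)"
    then obtain u where "u \<in> carrier \<Gamma>" "x = \<iota> u" by auto
    then show "\<exists>y\<in>carrier (E\<lparr>carrier := \<iota> ` carrier \<Gamma>\<rparr>). y \<otimes>\<^bsub>E\<lparr>carrier := \<iota> ` carrier \<Gamma>\<rparr>\<^esub> x
        = \<one>\<^bsub>E\<lparr>carrier := \<iota> ` carrier \<Gamma>\<rparr>\<^esub>"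
      by (intro bexI[of _ "\<iota> (inv\<^bsub>\<Gamma>\<^esub> u)"]) (auto simp: one_E)
  qed (auto simp: one_E G.m_ac)
next
  fix x assume "x \<in> carrier (E\<lparr>carrier := \<iota> ` carrier \<Gamma>\<rparr>)"
  \<comment> \<open>Because \<open>f (\<one>, \<one>)\<close> is neutral, each element of the image
    acts on the image as the identity.\<close>
  then have "bij_betw (\<lambda>y. x \<cdot>\<^bsub>E\<^esub> y) (\<iota> ` carrier \<Gamma>) (\<iota> ` carrier \<Gamma>) \<longleftrightarrow>
      bij_betw id (\<iota> ` carrier \<Gamma>) (\<iota> ` carrier \<Gamma>)"
    by (intro bij_betw_cong) auto
  then show "bij_betw (\<lambda>y. x \<cdot>\<^bsub>E\<lparr>carrier := \<iota> ` carrier \<Gamma>\<rparr>\<^esub> y)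
      (carrier (E\<lparr>carrier := \<iota> ` carrier \<Gamma>\<rparr>)) (carrier (E\<lparr>carrier := \<iota> ` carrier \<Gamma>\<rparr>))"
    by simp
qed auto

text \<open>Centrality is the normalization of \<open>f\<close>: a point over \<open>\<one>\<close>
  meets every other point in a value \<open>f (a, \<one>)\<close> or \<open>f (\<one>, a)\<close>,
  both neutral.\<close>

lemma central_extension_E: "central_extension A \<Gamma> (E, \<iota>, \<pi>)"
proof -
  have "x \<cdot>\<^bsub>E\<^esub> \<iota> u = \<iota> u \<and> \<iota> u \<cdot>\<^bsub>E\<^esub> x = x" if "x \<in> carrier E" "u \<in> carrier \<Gamma>" for x u
    using that by (auto elim: E_cases)
  then have "central_linear_cycle_subset (\<iota> ` carrier \<Gamma>) E"
    using linear_cycle_set_iota_image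
    unfolding central_linear_cycle_subset_def linear_cycle_subset_def by auto
  moreover have "lcs_short_exact (trivial_lcs \<Gamma>) E A \<iota> \<pi>"
    unfolding lcs_short_exact_def
    using linear_cycle_set_trivial[OF G.comm_group_axioms] linear_cycle_set_E
      linear_cycle_set_axioms iota_hom pi_hom iota_image pi_image
    by (simp add: trivial_lcs_def inj_on_def)
  ultimately show ?thesis by (simp add: central_extension_def)
qed

text \<open>The section through the pairs with trivial second coordinate returns
  \<open>(f, g)\<close> itself: as \<open>g (a, \<one>)\<close> is neutral, \<open>pt a u\<close> is
  just \<open>h (a, u)\<close>. Surjectivity of the class map rests on this.\<close>

sublocale central_ext_cochain A \<Gamma> E \<iota> \<pi> s f g
proof unfold_locales
  show "central_extension A \<Gamma> (E, \<iota>, \<pi>)" by (rule central_extension_E)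
  then interpret X: central_ext A \<Gamma> E \<iota> \<pi> by unfold_locales
  show "normalized_section A (E, \<iota>, \<pi>) s"
    by (auto simp: normalized_section_def one_E)
  then interpret X: sectioned_central_ext A \<Gamma> E \<iota> \<pi> s by unfold_locales
  show "section_cochain A \<Gamma> (E, \<iota>, \<pi>) s (f, g)"
    using Z2N_D(1,2)[OF fg] unfolding X.section_cochain_iff cochains2_def
    by (simp add: X.pt_def)
qed

end

section \<open>The class map and its bijectivity\<close>

text \<open>The set-theoretic first isomorphism theorem: \<open>f\<close> is constant on the classes
  of its kernel, so evaluating it at a chosen representative loses nothing.\<close>

lemma bij_betw_quotient_kernel:
  "bij_betw (\<lambda>C. f (SOME x. x \<in> C)) (S // {(x, y). x \<in> S \<and> y \<in> S \<and> f x = f y}) (f ` S)"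
    (is "bij_betw ?F (S // ?R) _")
proof -
  have cls: "?F (?R `` {x}) = f x" if "x \<in> S" for x
    using someI[of "\<lambda>y. y \<in> ?R `` {x}" x] that by auto
  show ?thesis
    unfolding bij_betw_def
  proof
    show "inj_on ?F (S // ?R)"
    proof (rule inj_onI)
      fix C D assume "C \<in> S // ?R" "D \<in> S // ?R" and eq: "?F C = ?F D"
      then obtain x y where "x \<in> S" "C = ?R `` {x}" "y \<in> S" "D = ?R `` {y}"
        by (auto elim!: quotientE)
      with eq show "C = D" using cls by auto
    qed
    have "S // ?R = (\<lambda>x. ?R `` {x}) ` S" by (auto simp: quotient_def)
    then have "?F ` (S // ?R) = (\<lambda>x. ?F (?R `` {x})) ` S" by (simp only: image_image)
    also have "\<dots> = f ` S" by (intro image_cong refl cls)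
    finally show "?F ` (S // ?R) = f ` S" .
  qed
qed

text \<open>One choice hides both the section and its cochain; \<open>extension_class_eq\<close>
  shows that the coset does not depend on it.\<close>

definition extension_class ::
  "[('a, 'm) lcs_scheme, ('g, 'n) monoid_scheme, ('g, 'e, 'a) extension] \<Rightarrow> ('a, 'g) cochain2 set" where
  "extension_class A \<Gamma> X = B2N A \<Gamma> #>\<^bsub>Z2N A \<Gamma>\<^esub>
     (SOME fg. \<exists>s. normalized_section A X s \<and> section_cochain A \<Gamma> X s fg)"

context lcs_coeff
begin

lemma section_cochain_exists:
  assumes "central_extension A \<Gamma> X"
  shows "\<exists>s. normalized_section A X s"
    and "normalized_section A X s \<Longrightarrow> \<exists>!fg. section_cochain A \<Gamma> X s fg"
proof -
  obtain E \<iota> \<pi> where X: "X = (E, \<iota>, \<pi>)" by (cases X)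
  interpret central_ext A \<Gamma> E \<iota> \<pi> using assms by unfold_locales (simp add: X)
  show "\<exists>s. normalized_section A X s" using normalized_section_exists by (simp add: X)
  assume "normalized_section A X s"
  then interpret sectioned_central_ext A \<Gamma> E \<iota> \<pi> s by unfold_locales (simp add: X)
  show "\<exists>!fg. section_cochain A \<Gamma> X s fg" using section_cochain_ex1 by (simp add: X)
qed

lemma section_cochainE:
  assumes "central_extension A \<Gamma> X"
  obtains s fg where "normalized_section A X s" "section_cochain A \<Gamma> X s fg"
proof -
  obtain s where s: "normalized_section A X s"
    using section_cochain_exists(1)[OF assms] ..
  with section_cochain_exists(2)[OF assms s] that show ?thesis by blast
qed

lemma section_cochain_mem_Z2N:
  assumes "central_extension A \<Gamma> X" "normalized_section A X s" "section_cochain A \<Gamma> X s fg"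
  shows "fg \<in> carrier (Z2N A \<Gamma>)"
proof -
  obtain E \<iota> \<pi> where X: "X = (E, \<iota>, \<pi>)" by (cases X)
  obtain f g where fg: "fg = (f, g)" by (metis surj_pair)
  interpret central_ext_cochain A \<Gamma> E \<iota> \<pi> s f g
    using assms unfolding X fg by unfold_locales
  show ?thesis using cochain_mem_Z2N by (simp add: fg)
qed

lemma extension_equiv_iff_coset_eq:
  assumes "central_extension A \<Gamma> X" "normalized_section A X s" "section_cochain A \<Gamma> X s fg"
    and "central_extension A \<Gamma> X'" "normalized_section A X' s'" "section_cochain A \<Gamma> X' s' fg'"
  shows "extension_equiv \<Gamma> X X' \<longleftrightarrow> B2N A \<Gamma> #>\<^bsub>Z2N A \<Gamma>\<^esub> fg = B2N A \<Gamma> #>\<^bsub>Z2N A \<Gamma>\<^esub> fg'"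
proof -
  obtain E \<iota> \<pi> E' \<iota>' \<pi>' where X: "X = (E, \<iota>, \<pi>)" "X' = (E', \<iota>', \<pi>')"
    by (cases X; cases X')
  obtain f g f' g' where fg: "fg = (f, g)" "fg' = (f', g')" by (metis surj_pair)
  interpret central_ext_cochain_pair A \<Gamma> E \<iota> \<pi> s f g E' \<iota>' \<pi>' s' f' g'
    using assms unfolding X fg by unfold_locales
  show ?thesis unfolding X fg by (rule equiv_iff_coset_eq)
qed

lemma extension_equiv_refl: "extension_equiv \<Gamma> X X"
  by (cases X) (auto simp: extension_equiv_def lcs_iso_def lcs_hom_def hom_def intro!: exI[of _ "\<lambda>x. x"] simp: bij_betw_def)

text \<open>Independence of the section: \<open>X\<close> is equivalent to itself, and the coset
  criterion is applied to \<open>X\<close> with the chosen section on one side and the given one on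
  the other.\<close>

lemma extension_class_eq:
  assumes "central_extension A \<Gamma> X" "normalized_section A X s" "section_cochain A \<Gamma> X s fg"
  shows "extension_class A \<Gamma> X = B2N A \<Gamma> #>\<^bsub>Z2N A \<Gamma>\<^esub> fg"
proof -
  have "\<exists>fg s. normalized_section A X s \<and> section_cochain A \<Gamma> X s fg" using assms by blast
  from someI_ex[OF this] obtain s' where "normalized_section A X s'"
    "section_cochain A \<Gamma> X s' (SOME fg. \<exists>s. normalized_section A X s \<and> section_cochain A \<Gamma> X s fg)"
    by blast
  from extension_equiv_iff_coset_eq[OF assms(1) this assms] extension_equiv_refl[of X]
  show ?thesis by (simp add: extension_class_def)
qed

lemma extension_equiv_iff_class_eq:
  assumes "central_extension A \<Gamma> X" "central_extension A \<Gamma> Y"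
  shows "extension_equiv \<Gamma> X Y \<longleftrightarrow> extension_class A \<Gamma> X = extension_class A \<Gamma> Y"
proof -
  obtain s fg where "normalized_section A X s" "section_cochain A \<Gamma> X s fg"
    by (rule section_cochainE[OF assms(1)])
  moreover obtain t fg' where "normalized_section A Y t" "section_cochain A \<Gamma> Y t fg'"
    by (rule section_cochainE[OF assms(2)])
  ultimately show ?thesis
    using assms by (simp add: extension_class_eq extension_equiv_iff_coset_eq)
qed

lemma extension_class_image:
  assumes "carrier A \<times> carrier \<Gamma> \<lesssim> (UNIV :: 'e set)"
  shows "extension_class A \<Gamma> ` {X :: ('g, 'e, 'a) extension. central_extension A \<Gamma> X}
    = carrier (H2N A \<Gamma>)"
proof (intro equalityI subsetI)
  fix C assume "C \<in> extension_class A \<Gamma> ` {X :: ('g, 'e, 'a) extension. central_extension A \<Gamma> X}"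
  then obtain X :: "('g, 'e, 'a) extension"
    where X: "C = extension_class A \<Gamma> X" "central_extension A \<Gamma> X" by auto
  obtain s fg where s: "normalized_section A X s" "section_cochain A \<Gamma> X s fg"
    by (rule section_cochainE[OF X(2)])
  have "C = B2N A \<Gamma> #>\<^bsub>Z2N A \<Gamma>\<^esub> fg" "fg \<in> carrier (Z2N A \<Gamma>)"
    using section_cochain_mem_Z2N[OF X(2) s] extension_class_eq[OF X(2) s] X(1) by blast+
  then show "C \<in> carrier (H2N A \<Gamma>)"
    by (auto simp: H2N_def FactGroup_def RCOSETS_def simp del: split_paired_Ex)
next
  fix C assume "C \<in> carrier (H2N A \<Gamma>)"
  then obtain f g where C: "C = B2N A \<Gamma> #>\<^bsub>Z2N A \<Gamma>\<^esub> (f, g)" "(f, g) \<in> carrier (Z2N A \<Gamma>)"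
    by (auto simp: H2N_def FactGroup_def RCOSETS_def)
  obtain h :: "'a \<times> 'g \<Rightarrow> 'e" where "inj_on h (carrier A \<times> carrier \<Gamma>)"
    using assms by (auto simp: lepoll_def)
  \<comment> \<open>The twisted product is built inside the given type and has the prescribed
    cocycle as a section cochain.\<close>
  with C interpret T: twisted_product A \<Gamma> f g h by unfold_locales
  have "C = extension_class A \<Gamma> (T.E, T.\<iota>, T.\<pi>)"
    using extension_class_eq[OF T.ext T.sec T.cochain] C by simp
  then show "C \<in> extension_class A \<Gamma> ` {X :: ('g, 'e, 'a) extension. central_extension A \<Gamma> X}"
    using T.ext by blast
qed

end

theorem theorem5p8:
  fixes A :: "('a, 'm) lcs_scheme" and \<Gamma> :: "('g, 'n) monoid_scheme"
  assumes "linear_cycle_set A" and "comm_group \<Gamma>"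
    and "carrier A \<times> carrier \<Gamma> \<lesssim> (UNIV :: 'e set)"
  shows "(\<forall>X :: ('g, 'e, 'a) extension. central_extension A \<Gamma> X \<longrightarrow>
            (\<exists>s. normalized_section A X s) \<and>
            (\<forall>s. normalized_section A X s \<longrightarrow>
               (\<exists>!fg. section_cochain A \<Gamma> X s fg) \<and>
               (\<forall>fg. section_cochain A \<Gamma> X s fg \<longrightarrow> fg \<in> carrier (Z2N A \<Gamma>)))) \<and>
         (\<exists>\<Phi> :: ('g, 'e, 'a) extension set \<Rightarrow> ('a, 'g) cochain2 set.
            (\<forall>X s fg. central_extension A \<Gamma> X \<longrightarrow> normalized_section A X s \<longrightarrow>
               section_cochain A \<Gamma> X s fg \<longrightarrow>
               \<Phi> (extension_rel A \<Gamma> `` {X}) = B2N A \<Gamma> #>\<^bsub>Z2N A \<Gamma>\<^esub> fg) \<and>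
            bij_betw \<Phi> (Ext A \<Gamma>) (carrier (H2N A \<Gamma>)))"
proof (intro conjI)
  interpret linear_cycle_set A by fact
  interpret G: comm_group \<Gamma> by fact
  interpret lcs_coeff A \<Gamma> by unfold_locales
  show "\<forall>X :: ('g, 'e, 'a) extension. central_extension A \<Gamma> X \<longrightarrow>
            (\<exists>s. normalized_section A X s) \<and>
            (\<forall>s. normalized_section A X s \<longrightarrow>
               (\<exists>!fg. section_cochain A \<Gamma> X s fg) \<and>
               (\<forall>fg. section_cochain A \<Gamma> X s fg \<longrightarrow> fg \<in> carrier (Z2N A \<Gamma>)))"
    using section_cochain_exists section_cochain_mem_Z2N by blast
  define \<Phi> where "\<Phi> C = extension_class A \<Gamma> (SOME X. X \<in> C)" for C :: "('g, 'e, 'a) extension set"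
  \<comment> \<open>In this form the relation is the kernel of the class map on central extensions,
    as \<open>bij_betw_quotient_kernel\<close> requires.\<close>
  have rel: "(extension_rel A \<Gamma> :: ('g, 'e, 'a) extension rel) = {(X, Y). X \<in> {X. central_extension A \<Gamma> X} \<and>
      Y \<in> {X. central_extension A \<Gamma> X} \<and> extension_class A \<Gamma> X = extension_class A \<Gamma> Y}"
    unfolding extension_rel_def using extension_equiv_iff_class_eq by blast
  have "bij_betw \<Phi> (Ext A \<Gamma>) (carrier (H2N A \<Gamma>))"
    using bij_betw_quotient_kernel[of "extension_class A \<Gamma>"
        "{X :: ('g, 'e, 'a) extension. central_extension A \<Gamma> X}"]
    unfolding \<Phi>_def Ext_def rel extension_class_image[OF assms(3)] by simp
  moreover have "\<Phi> (extension_rel A \<Gamma> `` {X}) = B2N A \<Gamma> #>\<^bsub>Z2N A \<Gamma>\<^esub> fg"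
    if X: "central_extension A \<Gamma> X" "normalized_section A X s" "section_cochain A \<Gamma> X s fg"
    for X :: "('g, 'e, 'a) extension" and s fg
  proof -
    \<comment> \<open>The representative picked by \<Phi> may differ from \<open>X\<close>, but it
      is related to \<open>X\<close> and hence has the same class.\<close>
    define Y where "Y = (SOME Y. Y \<in> extension_rel A \<Gamma> `` {X})"
    have "Y \<in> extension_rel A \<Gamma> `` {X}"
      unfolding Y_def by (rule someI[of _ X]) (simp add: rel X)
    then have "extension_class A \<Gamma> Y = extension_class A \<Gamma> X"
      by (simp add: rel)
    then have "\<Phi> (extension_rel A \<Gamma> `` {X}) = extension_class A \<Gamma> X"
      by (simp add: \<Phi>_def Y_def)
    with extension_class_eq[OF X] show ?thesis by simp
  qed
  ultimately show "\<exists>\<Phi> :: ('g, 'e, 'a) extension set \<Rightarrow> ('a, 'g) cochain2 set.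
            (\<forall>X s fg. central_extension A \<Gamma> X \<longrightarrow> normalized_section A X s \<longrightarrow>
               section_cochain A \<Gamma> X s fg \<longrightarrow>
               \<Phi> (extension_rel A \<Gamma> `` {X}) = B2N A \<Gamma> #>\<^bsub>Z2N A \<Gamma>\<^esub> fg) \<and>
            bij_betw \<Phi> (Ext A \<Gamma>) (carrier (H2N A \<Gamma>))"
    by blast
qed

end
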